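(* Let $\mathcal{P}_{\mathrm{lo}}$ be the lattice of all lower stable C*-properties. (i) The map $P\mapsto\mathsf{dG}P$ is a closure operator in $\mathcal{P}_{\mathrm{lo}}$, that is, $P\subseteq\mathsf{dG}P=\mathsf{dG}(\mathsf{dG}P)$ for $P\in\mathcal{P}_{\mathrm{lo}}$, and $\mathsf{dG}P\subseteq\mathsf{dG}P_1$ if $P\subseteq P_1$ in $\mathcal{P}_{\mathrm{lo}}$. In the latter case $\mathfrak{p}_{P_1}^{\triangleleft}(A)\subseteq\mathfrak{p}_P^{\triangleleft}(A)$ in $\mathrm{Id}_A$ for each C*-algebra $A$. (ii) If $P,P_1\in\mathcal{P}_{\mathrm{lo}}$ and $P\subseteq\mathsf{dG}P_1$, then $\mathsf{dG}P\subseteq\mathsf{dG}P_1$. (iii) If $P\subseteq P_1\subseteq\mathsf{dG}P$ in $\mathcal{P}_{\mathrm{lo}}$, then $\mathsf{dG}P=\mathsf{dG}P_1$ and $\mathfrak{p}_P^{\triangleleft}(A)=\mathfrak{p}_{P_1}^{\triangleleft}(A)$ in $\mathrm{Id}_A$ for every C*-algebra $A$.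
   Context: For a C*-algebra $A$, $\mathrm{Id}_A$ is the lattice of all closed two-sided ideals of $A$ (called ideals), ordered by inclusion. A C*-property is a class $P$ of C*-algebras with $\{0\}\in P$ that is closed under *-isomorphism. $P$ is lower stable if $A\in P$ implies $I\in P$ for all $I\in\mathrm{Id}_A$. $\mathcal{P}_{\mathrm{lo}}$ is the complete lattice of all lower stable C*-properties ordered by inclusion. The relation $\ll_P$ in $\mathrm{Id}_A$ is: $I\ll_P J$ iff $I\subseteq J$ and $J/I\in P$. $\mathsf{dG}P$ is the C*-property of all C*-algebras $A$ such that $A=\{0\}$ or for each $\{0\}\neq J\in\mathrm{Id}_A$ there is $I\in\mathrm{Id}_A$ with $I\subsetneqq J$ and $J/I\in P$ (it is always lower stable). Write $I\ll_P^{\triangleleft}J$ if there is a family of ideals $(I_\lambda)_{1\le\lambda\le\gamma}$ ($\gamma$ an ordinal) with $I_1=J$, $I_\gamma=I$, $I_{\lambda+1}\ll_P I_\lambda$ for $\lambda<\gamma$, and $I_\beta=\bigcap_{\lambda<\beta}I_\lambda$ for limit ordinals $\beta$. For $P$ lower stable, $\mathfrak{p}_P^{\triangleleft}(A)=\bigcap\{J\in\mathrm{Id}_A:J\ll_P^{\triangleleft}A\}$ (the dual $\ll_P^{\triangleleft}$-radical). *)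

theory Defs
  imports "HOL-Analysis.Abstract_Metric_Spaces" "HOL-Algebra.QuotRing" "HOL-Algebra.Module"
begin

section \<open>C*-algebras with explicit carriers\<close>

definition complex_ring :: "complex ring" where
  "complex_ring = \<lparr>carrier = UNIV, mult = (*), one = 1, zero = 0, add = (+)\<rparr>"

text \<open>C*-algebras are not assumed to be unital: the field \<^const>\<open>one\<close>, inherited from the ring
  record, is not used.\<close>

record 'a cstar = "(complex, 'a) module" +
  star :: "'a \<Rightarrow> 'a"
  nrm :: "'a \<Rightarrow> real"

text \<open>The value outside the carrier is only there because \<^locale>\<open>Metric_space\<close> asks for
  non-negativity and symmetry on the whole type.\<close>

definition nrm_dist :: "('a, 'b) cstar_scheme \<Rightarrow> 'a \<Rightarrow> 'a \<Rightarrow> real" where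
  "nrm_dist A x y =
     (if x \<in> carrier A \<and> y \<in> carrier A then nrm A (x \<ominus>\<^bsub>A\<^esub> y) else 0)"

locale cstar_algebra = Module.module complex_ring A for A :: "('a, 'b) cstar_scheme" (structure) +
  assumes mult_closed: "\<lbrakk>x \<in> carrier A; y \<in> carrier A\<rbrakk> \<Longrightarrow> x \<otimes> y \<in> carrier A"
    and mult_assoc: "\<lbrakk>x \<in> carrier A; y \<in> carrier A; z \<in> carrier A\<rbrakk>
      \<Longrightarrow> (x \<otimes> y) \<otimes> z = x \<otimes> (y \<otimes> z)"
    and distrib_right: "\<lbrakk>x \<in> carrier A; y \<in> carrier A; z \<in> carrier A\<rbrakk>
      \<Longrightarrow> (x \<oplus> y) \<otimes> z = x \<otimes> z \<oplus> y \<otimes> z"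
    and distrib_left: "\<lbrakk>x \<in> carrier A; y \<in> carrier A; z \<in> carrier A\<rbrakk>
      \<Longrightarrow> z \<otimes> (x \<oplus> y) = z \<otimes> x \<oplus> z \<otimes> y"
    and smult_mult_left: "\<lbrakk>x \<in> carrier A; y \<in> carrier A\<rbrakk> \<Longrightarrow> (c \<odot> x) \<otimes> y = c \<odot> (x \<otimes> y)"
    and smult_mult_right: "\<lbrakk>x \<in> carrier A; y \<in> carrier A\<rbrakk> \<Longrightarrow> x \<otimes> (c \<odot> y) = c \<odot> (x \<otimes> y)"
    and star_closed: "x \<in> carrier A \<Longrightarrow> star A x \<in> carrier A"
    and star_star: "x \<in> carrier A \<Longrightarrow> star A (star A x) = x"
    and star_add: "\<lbrakk>x \<in> carrier A; y \<in> carrier A\<rbrakk> \<Longrightarrow> star A (x \<oplus> y) = star A x \<oplus> star A y"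
    and star_smult: "x \<in> carrier A \<Longrightarrow> star A (c \<odot> x) = cnj c \<odot> star A x"
    and star_mult: "\<lbrakk>x \<in> carrier A; y \<in> carrier A\<rbrakk> \<Longrightarrow> star A (x \<otimes> y) = star A y \<otimes> star A x"
    and nrm_nonneg: "x \<in> carrier A \<Longrightarrow> 0 \<le> nrm A x"
    and nrm_eq_0_iff: "x \<in> carrier A \<Longrightarrow> nrm A x = 0 \<longleftrightarrow> x = \<zero>"
    and nrm_triangle: "\<lbrakk>x \<in> carrier A; y \<in> carrier A\<rbrakk> \<Longrightarrow> nrm A (x \<oplus> y) \<le> nrm A x + nrm A y"
    and nrm_smult: "x \<in> carrier A \<Longrightarrow> nrm A (c \<odot> x) = cmod c * nrm A x"
    and nrm_mult: "\<lbrakk>x \<in> carrier A; y \<in> carrier A\<rbrakk> \<Longrightarrow> nrm A (x \<otimes> y) \<le> nrm A x * nrm A y"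
    and cstar_identity: "x \<in> carrier A \<Longrightarrow> nrm A (star A x \<otimes> x) = (nrm A x)\<^sup>2"
    and complete: "Metric_space.mcomplete (carrier A) (nrm_dist A)"

definition star_isomorphism :: "('a, 'c) cstar_scheme \<Rightarrow> ('b, 'd) cstar_scheme \<Rightarrow> ('a \<Rightarrow> 'b) \<Rightarrow> bool"
  where "star_isomorphism A B f \<longleftrightarrow>
     bij_betw f (carrier A) (carrier B) \<and>
     (\<forall>x\<in>carrier A. \<forall>y\<in>carrier A. f (x \<oplus>\<^bsub>A\<^esub> y) = f x \<oplus>\<^bsub>B\<^esub> f y) \<and>
     (\<forall>c. \<forall>x\<in>carrier A. f (c \<odot>\<^bsub>A\<^esub> x) = c \<odot>\<^bsub>B\<^esub> f x) \<and>
     (\<forall>x\<in>carrier A. \<forall>y\<in>carrier A. f (x \<otimes>\<^bsub>A\<^esub> y) = f x \<otimes>\<^bsub>B\<^esub> f y) \<and>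
     (\<forall>x\<in>carrier A. f (star A x) = star B (f x))"

definition star_isomorphic :: "('a, 'c) cstar_scheme \<Rightarrow> ('b, 'd) cstar_scheme \<Rightarrow> bool"
  where "star_isomorphic A B \<longleftrightarrow> (\<exists>f. star_isomorphism A B f)"


section \<open>Ideals and quotients\<close>

definition cstar_ideals :: "'a cstar \<Rightarrow> 'a set set" where
  "cstar_ideals A = {I. submodule I complex_ring A \<and>
     (\<forall>a\<in>carrier A. \<forall>x\<in>I. a \<otimes>\<^bsub>A\<^esub> x \<in> I \<and> x \<otimes>\<^bsub>A\<^esub> a \<in> I) \<and>
     closedin (Metric_space.mtopology (carrier A) (nrm_dist A)) I}"

abbreviation subalg :: "'a cstar \<Rightarrow> 'a set \<Rightarrow> 'a cstar" where
  "subalg A J \<equiv> A\<lparr>carrier := J\<rparr>"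

text \<open>The operations on cosets are written in the style of \<^const>\<open>rcoset_mult\<close>: the result is the
  coset of the result for any representatives.\<close>

definition quotient :: "'a cstar \<Rightarrow> 'a set \<Rightarrow> 'a set cstar" where
  "quotient A I =
     \<lparr>carrier = a_rcosets\<^bsub>A\<^esub> I,
      mult = rcoset_mult A I,
      one = undefined,
      zero = I,
      add = set_add A,
      smult = (\<lambda>c X. \<Union>x\<in>X. I +>\<^bsub>A\<^esub> (c \<odot>\<^bsub>A\<^esub> x)),
      star = (\<lambda>X. \<Union>x\<in>X. I +>\<^bsub>A\<^esub> (star A x)),
      nrm = (\<lambda>X. INF x\<in>X. nrm A x)\<rparr>"


section \<open>C*-properties\<close>

text \<open>A class of C*-algebras is rendered as a set of C*-algebras whose carriers are subsets of one
  type \<open>'a\<close>, which is arbitrary and plays the role of the universe.\<close>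

definition cstar_property :: "'a cstar set \<Rightarrow> bool" where
  "cstar_property P \<longleftrightarrow>
     (\<forall>A\<in>P. cstar_algebra A) \<and>
     (\<forall>A. cstar_algebra A \<and> carrier A = {\<zero>\<^bsub>A\<^esub>} \<longrightarrow> A \<in> P) \<and>
     (\<forall>A B. A \<in> P \<and> cstar_algebra B \<and> star_isomorphic A B \<longrightarrow> B \<in> P)"

text \<open>A quotient has carrier type \<open>'a set\<close>, so it belongs to an isomorphism-closed class if some
  isomorphic copy with carrier in \<open>'a\<close> does. Copies always exist: choose a representative of each
  coset and transport the structure.\<close>

definition quotient_in :: "'a cstar set \<Rightarrow> 'a cstar \<Rightarrow> 'a set \<Rightarrow> 'a set \<Rightarrow> bool" where
  "quotient_in P A J I \<longleftrightarrow> (\<exists>B\<in>P. star_isomorphic B (quotient (subalg A J) I))"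

definition lower_stable :: "'a cstar set \<Rightarrow> bool" where
  "lower_stable P \<longleftrightarrow> (\<forall>A\<in>P. \<forall>I\<in>cstar_ideals A. subalg A I \<in> P)"

definition P_lo :: "'a cstar set set" where
  "P_lo = {P. cstar_property P \<and> lower_stable P}"

definition dG :: "'a cstar set \<Rightarrow> 'a cstar set" where
  "dG P = {A. cstar_algebra A \<and>
     (carrier A = {\<zero>\<^bsub>A\<^esub>} \<or>
      (\<forall>J\<in>cstar_ideals A. J \<noteq> {\<zero>\<^bsub>A\<^esub>} \<longrightarrow> (\<exists>I\<in>cstar_ideals A. I \<subset> J \<and> quotient_in P A J I)))}"

definition ll :: "'a cstar set \<Rightarrow> 'a cstar \<Rightarrow> 'a set \<Rightarrow> 'a set \<Rightarrow> bool" where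
  "ll P A I J \<longleftrightarrow> I \<in> cstar_ideals A \<and> J \<in> cstar_ideals A \<and> I \<subseteq> J \<and> quotient_in P A J I"


section \<open>Descending transfinite chains and the dual radical\<close>

definition limit_elem :: "'i rel \<Rightarrow> 'i \<Rightarrow> bool" where
  "limit_elem r b \<longleftrightarrow> b \<in> Field r \<and> underS r b \<noteq> {} \<and>
     (\<forall>i\<in>underS r b. wo_rel.suc r {i} \<noteq> b)"

text \<open>The ordinals \<open>1 \<le> \<lambda> \<le> \<gamma>\<close> are represented by a well-order \<open>r\<close> with least element \<open>b\<close> (for 1) and
  greatest element \<open>g\<close> (for \<open>\<gamma>\<close>); \<open>wo_rel.suc r {i}\<close> is the successor of \<open>i\<close>. The well-order lives
  on the type \<open>'a set\<close> of the ideals. This bound on \<open>\<gamma>\<close> does not change the relation: omitting repetitions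
  from a chain leaves a strictly decreasing one with the same end points, and its index set embeds
  into the set of ideals.\<close>

definition ll_dual :: "'a cstar set \<Rightarrow> 'a cstar \<Rightarrow> 'a set \<Rightarrow> 'a set \<Rightarrow> bool" where
  "ll_dual P A I J \<longleftrightarrow>
     (\<exists>(r :: 'a set rel) b g F.
        Well_order r \<and> b \<in> Field r \<and> g \<in> Field r \<and>
        (\<forall>i\<in>Field r. (b, i) \<in> r \<and> (i, g) \<in> r) \<and>
        (\<forall>i\<in>Field r. F i \<in> cstar_ideals A) \<and> F b = J \<and> F g = I \<and>
        (\<forall>i\<in>underS r g. ll P A (F (wo_rel.suc r {i})) (F i)) \<and>
        (\<forall>i. limit_elem r i \<longrightarrow> F i = (\<Inter>j\<in>underS r i. F j)))"

definition dual_radical :: "'a cstar set \<Rightarrow> 'a cstar \<Rightarrow> 'a set" where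
  "dual_radical P A = \<Inter>{J \<in> cstar_ideals A. ll_dual P A J (carrier A)}"

end

theory Submission
  imports Defs "HOL-Analysis.Urysohn" "HOL-Library.Bourbaki_Witt_Fixpoint"
begin

text \<open>
  A quotient \<open>J / I\<close> belongs to a C*-property \<open>P\<close> if and only if some \<open>B \<in> P\<close> is the image of \<open>J\<close> under a
  *-homomorphism with kernel \<open>I\<close> (\<open>quotient_in_iff_hom\<close>). Closed ideals of \<open>B\<close> can then be pulled back to \<open>J\<close>,
  with the same quotients (\<open>quotient_in_vimage\<close>). Two facts about C*-algebras make this work: *-homomorphisms are contractive
  (\<open>contractive\<close>), so preimages of closed ideals are closed; and closed ideals are self-adjoint and
  their closed ideals are ideals of the whole algebra (\<open>cstar_ideal_star\<close>, \<open>cstar_ideal_of_ideal\<close>).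

  Both facts are obtained from the contraction principle. If \<open>h\<close> is self-adjoint with norm below 1, then \<open>h\<close>
  is the real part of the unitary \<open>h + \<i> sqrt (1 - h\<^sup>2)\<close>, and a *-homomorphism maps unitaries to unitaries, which have
  norm 1. If \<open>x\<close> lies in a closed ideal, then so does \<open>u = h (h - \<i>e)\<^sup>-\<^sup>1\<close> with \<open>h = x\<^sup>*x\<close>, and \<open>x u\<close> tends to \<open>x\<close> as
  \<open>e\<close> tends to zero.

  For idempotence of \<open>dG\<close>, a nonzero ideal of an algebra in \<open>dG (dG P)\<close> has a nonzero quotient in \<open>dG P\<close>, which in turn
  has a nonzero quotient in \<open>P\<close> (\<open>dG_idem\<close>). Together with monotonicity this gives everything about \<open>dG\<close>.

  For the radicals it suffices that a descending chain for \<open>dG P\<close> can be refined to a chain for \<open>P\<close> with the same end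
  points (\<open>ll_dual_dG_imp_ll_dual\<close>). If \<open>K / L \<cong> B \<in> dG P\<close>, then the definition of \<open>dG\<close> provides a descent from
  \<open>B\<close> to zero through closed ideals of \<open>B\<close> by steps from \<open>P\<close>, and the preimages descend from \<open>K\<close> to \<open>L\<close>. To concatenate
  these refinements transfinitely, all of them are produced by iterating one decreasing function on ideals.
  Its tower of iterates in the sense of Bourbaki and Witt contains the given chain, and the part of the tower above
  an ideal is a chain as required (\<open>segment_well_order\<close>).
\<close>

section \<open>Arithmetic and metric of a C*-algebra\<close>

lemma complex_ring_simps [simp]:
  "carrier complex_ring = UNIV" "a \<otimes>\<^bsub>complex_ring\<^esub> b = a * b" "\<one>\<^bsub>complex_ring\<^esub> = 1"
  "\<zero>\<^bsub>complex_ring\<^esub> = 0" "a \<oplus>\<^bsub>complex_ring\<^esub> b = a + b"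
  by (simp_all add: complex_ring_def)

context cstar_algebra
begin

lemma smult_in_carrier [simp, intro]: "x \<in> carrier A \<Longrightarrow> c \<odot> x \<in> carrier A"
  using smult_closed[of c x] by simp

lemma smult_add_left: "x \<in> carrier A \<Longrightarrow> (a + b) \<odot> x = a \<odot> x \<oplus> b \<odot> x"
  using smult_l_distr[of a b x] by simp

lemma smult_add_right: "\<lbrakk>x \<in> carrier A; y \<in> carrier A\<rbrakk> \<Longrightarrow> c \<odot> (x \<oplus> y) = c \<odot> x \<oplus> c \<odot> y"
  using smult_r_distr[of c x y] by simp

lemma smult_smult: "x \<in> carrier A \<Longrightarrow> a \<odot> (b \<odot> x) = (a * b) \<odot> x"
  using smult_assoc1[of a b x] by simp

lemma smult_1 [simp]: "x \<in> carrier A \<Longrightarrow> 1 \<odot> x = x"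
  using smult_one[of x] by simp

lemma smult_0 [simp]: "x \<in> carrier A \<Longrightarrow> 0 \<odot> x = \<zero>"
  using smult_l_null[of x] by simp

lemma smult_zero_right [simp]: "c \<odot> \<zero> = \<zero>"
  using smult_r_null[of c] by simp

lemma a_inv_eq_smult: "x \<in> carrier A \<Longrightarrow> \<ominus> x = (-1) \<odot> x"
proof -
  assume x: "x \<in> carrier A"
  have "(-1) \<odot> x \<oplus> x = (-1 + 1) \<odot> x" using x by (subst smult_add_left) simp_all
  also have "\<dots> = \<zero>" using x by simp
  finally show ?thesis using x minus_equality by fastforce
qed

lemma minus_eq_smult: "\<lbrakk>x \<in> carrier A; y \<in> carrier A\<rbrakk> \<Longrightarrow> x \<ominus> y = x \<oplus> (-1) \<odot> y"
  by (simp add: minus_eq a_inv_eq_smult)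

lemmas closed_simps [simp, intro] = mult_closed star_closed

lemma mult_zero [simp]:
  assumes "x \<in> carrier A" shows "x \<otimes> \<zero> = \<zero>" "\<zero> \<otimes> x = \<zero>"
  using smult_mult_right[of x \<zero> 0] smult_mult_left[of \<zero> x 0] assms by simp_all

lemmas expand = distrib_left distrib_right smult_add_right smult_mult_left smult_mult_right
  smult_smult star_add star_smult star_mult star_star minus_eq_smult mult_assoc

lemma nrm_zero [simp]: "nrm A \<zero> = 0" using nrm_eq_0_iff by simp

lemma nrm_star [simp]:
  assumes x: "x \<in> carrier A" shows "nrm A (star A x) = nrm A x"
proof -
  have le: "nrm A y \<le> nrm A (star A y)" if y: "y \<in> carrier A" for y
  proof (cases "nrm A y = 0")
    case False
    have "(nrm A y)\<^sup>2 \<le> nrm A (star A y) * nrm A y"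
      using nrm_mult[of "star A y" y] cstar_identity[of y] y by simp
    then show ?thesis
      using False nrm_nonneg[OF y] by (simp add: power2_eq_square)
  qed (use nrm_nonneg y in simp)
  show ?thesis using le[OF x] le[of "star A x"] x by (simp add: star_star)
qed

lemma nrm_minus_swap:
  "\<lbrakk>x \<in> carrier A; y \<in> carrier A\<rbrakk> \<Longrightarrow> nrm A (x \<ominus> y) = nrm A (y \<ominus> x)"
proof -
  assume *: "x \<in> carrier A" "y \<in> carrier A"
  have "x \<ominus> y = (-1) \<odot> (y \<ominus> x)" using * by (simp add: expand a_ac)
  then show ?thesis using * by (simp add: nrm_smult)
qed

lemma minus_add_minus:
  "\<lbrakk>x \<in> carrier A; y \<in> carrier A; z \<in> carrier A\<rbrakk> \<Longrightarrow> (x \<ominus> y) \<oplus> (y \<ominus> z) = x \<ominus> z"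
proof -
  assume *: "x \<in> carrier A" "y \<in> carrier A" "z \<in> carrier A"
  have "(x \<ominus> y) \<oplus> (y \<ominus> z) = x \<oplus> (((-1) \<odot> y \<oplus> y) \<oplus> (-1) \<odot> z)"
    using * by (simp add: expand a_ac)
  also have "(-1) \<odot> y \<oplus> y = \<zero>"
    using * by (metis a_inv_eq_smult l_neg)
  finally show ?thesis using * by (simp add: minus_eq_smult)
qed

lemma minus_eq_zero_iff: "\<lbrakk>x \<in> carrier A; y \<in> carrier A\<rbrakk> \<Longrightarrow> x \<ominus> y = \<zero> \<longleftrightarrow> x = y"
  by (metis add.inv_solve_right' l_zero minus_eq zero_closed)

lemma minus_add_cancel: "\<lbrakk>x \<in> carrier A; y \<in> carrier A\<rbrakk> \<Longrightarrow> (x \<ominus> y) \<oplus> y = x"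
  by (simp add: minus_eq a_assoc l_neg)

lemma metric_space_nrm: "Metric_space (carrier A) (nrm_dist A)"
proof
  fix x y z
  show "0 \<le> nrm_dist A x y" by (simp add: nrm_dist_def nrm_nonneg)
  show "nrm_dist A x y = nrm_dist A y x" by (simp add: nrm_dist_def nrm_minus_swap)
  { assume "x \<in> carrier A" "y \<in> carrier A" 
    then show "(nrm_dist A x y = 0) = (x = y)"
      by (simp add: nrm_dist_def nrm_eq_0_iff minus_eq_zero_iff) }
  assume *: "x \<in> carrier A" "y \<in> carrier A" "z \<in> carrier A"
  show "nrm_dist A x z \<le> nrm_dist A x y + nrm_dist A y z"
    using nrm_triangle[of "x \<ominus> y" "y \<ominus> z"] * minus_add_minus by (simp add: nrm_dist_def)
qed

sublocale M: Metric_space "carrier A" "nrm_dist A"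
  by (rule metric_space_nrm)

lemma closedin_iff_approx:
  "closedin M.mtopology S \<longleftrightarrow> S \<subseteq> carrier A \<and>
     (\<forall>x\<in>carrier A. (\<forall>e>0. \<exists>y\<in>S. nrm A (x \<ominus> y) < e) \<longrightarrow> x \<in> S)"
proof -
  have "disjnt S (M.mball x r) \<longleftrightarrow> \<not> (\<exists>y\<in>S. nrm A (x \<ominus> y) < r)"
    if "S \<subseteq> carrier A" "x \<in> carrier A" for x r
    using that by (auto simp: disjnt_iff M.in_mball nrm_dist_def subset_iff)
  then show ?thesis
    unfolding M.closedin_metric by (metis DiffD1 DiffD2 DiffI)
qed

text \<open>All constructions of elements below use this principle: the resolvents of self-adjoint elements and
  the complements of self-adjoint contractions to unitaries are fixed points of contractions.\<close>

lemma contraction_fixed_point: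
  assumes cl: "closedin M.mtopology S" and ne: "S \<noteq> {}"
    and f: "\<And>x. x \<in> S \<Longrightarrow> f x \<in> S" and q: "q < 1"
    and lip: "\<And>x y. \<lbrakk>x \<in> S; y \<in> S\<rbrakk> \<Longrightarrow> nrm A (f x \<ominus> f y) \<le> q * nrm A (x \<ominus> y)"
  obtains x where "x \<in> S" "f x = x"
proof -
  have sub: "S \<subseteq> carrier A" using cl closedin_iff_approx by blast
  interpret S: Submetric "carrier A" "nrm_dist A" S
    by unfold_locales (rule sub)
  have mc: "S.sub.mcomplete" using S.closedin_mcomplete_imp_mcomplete cl complete by blast
  obtain x where "x \<in> S" "f x = x"
    by (rule S.sub.Banach_fixedpoint_thm[OF mc ne, where k = q and f = f])
       (use f q lip sub in \<open>auto simp: nrm_dist_def subset_iff\<close>)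
  then show ?thesis using that by blast
qed


section \<open>Resolvents of self-adjoint elements\<close>

lemma smult_cancel [simp]:
  assumes "x \<in> carrier A" shows "a \<odot> x \<oplus> (-a) \<odot> x = \<zero>" "(-a) \<odot> x \<oplus> a \<odot> x = \<zero>"
  using smult_add_left[OF assms, of a "-a"] smult_add_left[OF assms, of "-a" a] assms by simp_all

lemma smult_cancel_l [simp]:
  assumes "x \<in> carrier A" "y \<in> carrier A"
  shows "a \<odot> x \<oplus> ((-a) \<odot> x \<oplus> y) = y" "(-a) \<odot> x \<oplus> (a \<odot> x \<oplus> y) = y"
  using assms smult_cancel[of x a] by (simp_all flip: a_assoc)

lemma nrm_minus_le: "\<lbrakk>x \<in> carrier A; y \<in> carrier A\<rbrakk> \<Longrightarrow> nrm A (x \<ominus> y) \<le> nrm A x + nrm A y"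
  using nrm_triangle[of x "(-1) \<odot> y"] by (simp add: minus_eq_smult nrm_smult)

text \<open>The mixed terms \<open>\<i> p\<^sup>*q\<close> and \<open>-\<i> q\<^sup>*p\<close> of \<open>(p + \<i>q)\<^sup>*(p + \<i>q)\<close> cancel, which turns the C*-identity
  into a substitute for the Pythagorean theorem.\<close>

lemma nrm_add_imaginary:
  assumes p: "p \<in> carrier A" and q: "q \<in> carrier A" and comm: "star A p \<otimes> q = star A q \<otimes> p"
  shows "(nrm A (p \<oplus> \<i> \<odot> q))\<^sup>2 = nrm A (star A p \<otimes> p \<oplus> star A q \<otimes> q)"
proof -
  have "star A (p \<oplus> \<i> \<odot> q) \<otimes> (p \<oplus> \<i> \<odot> q)
      = star A p \<otimes> p \<oplus> (\<i> \<odot> (star A p \<otimes> q) \<oplus> ((- \<i>) \<odot> (star A q \<otimes> p) \<oplus> star A q \<otimes> q))"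
    using p q by (simp add: expand a_ac)
  also have "\<dots> = star A p \<otimes> p \<oplus> star A q \<otimes> q"
    using p q by (simp add: comm)
  finally show ?thesis
    using cstar_identity[of "p \<oplus> \<i> \<odot> q"] p q by simp
qed

text \<open>Left multiplication by \<open>h + \<i>c\<close> with \<open>h\<close> self-adjoint and \<open>c\<close> real has norm at most
  \<open>sqrt (nrm A h ^ 2 + c ^ 2)\<close>. This is a quantitative form of the fact that the spectrum of \<open>h\<close> is real: the bound exceeds
  \<open>\<bar>c\<bar>\<close> by an amount that vanishes as \<open>c\<close> grows.\<close>

lemma nrm_shift:
  assumes h: "h \<in> carrier A" "star A h = h" and y: "y \<in> carrier A"
  shows "(nrm A (h \<otimes> y \<oplus> (\<i> * of_real c) \<odot> y))\<^sup>2 \<le> ((nrm A h)\<^sup>2 + c\<^sup>2) * (nrm A y)\<^sup>2"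
proof -
  define q where "q = complex_of_real c \<odot> y"
  have q: "q \<in> carrier A" and sq: "star A q = complex_of_real c \<odot> star A y"
    using y by (simp_all add: q_def star_smult)
  have "(nrm A (h \<otimes> y \<oplus> \<i> \<odot> q))\<^sup>2
      = nrm A (star A (h \<otimes> y) \<otimes> (h \<otimes> y) \<oplus> star A q \<otimes> q)"
    using h y by (intro nrm_add_imaginary) (simp_all add: q_def expand)
  also have "\<dots> \<le> nrm A (star A (h \<otimes> y) \<otimes> (h \<otimes> y)) + nrm A (star A q \<otimes> q)"
    using h y q by (intro nrm_triangle) auto
  also have "\<dots> = (nrm A (h \<otimes> y))\<^sup>2 + (nrm A q)\<^sup>2"
    using h y q by (simp add: cstar_identity)
  also have "\<dots> \<le> (nrm A h * nrm A y)\<^sup>2 + (\<bar>c\<bar> * nrm A y)\<^sup>2"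
    using h y nrm_mult[of h y] nrm_nonneg
    by (intro add_mono power_mono) (simp_all add: q_def nrm_smult power_mult_distrib)
  finally show ?thesis
    using y by (simp add: q_def smult_smult power_mult_distrib ring_distribs)
qed

text \<open>The equation \<open>(h - \<i>e) y = z\<close> is equivalent to \<open>y = ((h + \<i>c) y - z) / (\<i>(e + c))\<close>. The right-hand
  side is a contraction as soon as \<open>sqrt (nrm A h ^ 2 + c ^ 2) < e + c\<close>, that is, for large \<open>c\<close>.\<close>

lemma resolvent_exists:
  assumes h: "h \<in> carrier A" "star A h = h" and e: "e > 0" and z: "z \<in> carrier A"
  obtains y where "y \<in> carrier A" "h \<otimes> y = z \<oplus> (\<i> * complex_of_real e) \<odot> y"
proof -
  \<comment> \<open>This choice makes \<open>2 e c\<close> equal to the square of the norm of \<open>h\<close>.\<close>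
  define c where "c = (nrm A h)\<^sup>2 / (2 * e)"
  define T where "T y = h \<otimes> y \<oplus> (\<i> * complex_of_real c) \<odot> y" for y
  define s where "s = sqrt ((nrm A h)\<^sup>2 + c\<^sup>2)"
  define k where "k = \<i> * complex_of_real (e + c)"
  have c: "c \<ge> 0" using e by (simp add: c_def)
  have "(nrm A h)\<^sup>2 = 2 * e * c" using e by (simp add: c_def)
  then have "(nrm A h)\<^sup>2 + c\<^sup>2 < (e + c)\<^sup>2"
    using e by (simp add: power2_sum)
  then have s: "s < e + c" "0 \<le> s"
    using e c by (auto simp: s_def intro: real_less_lsqrt)
  have k: "k \<noteq> 0" "cmod k = e + c" using e c by (auto simp: k_def norm_mult simp del: of_real_add)
  have Tc: "T y \<in> carrier A" if "y \<in> carrier A" for y using that h by (simp add: T_def)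
  have Tle: "nrm A (T y) \<le> s * nrm A y" if y: "y \<in> carrier A" for y
  proof (rule power2_le_imp_le)
    show "(nrm A (T y))\<^sup>2 \<le> (s * nrm A y)\<^sup>2"
      using nrm_shift[OF h y, of c] by (simp add: T_def s_def power_mult_distrib)
  qed (use s nrm_nonneg y in simp)
  have lip: "nrm A ((1/k) \<odot> (T x \<ominus> z) \<ominus> (1/k) \<odot> (T y \<ominus> z)) \<le> s / (e + c) * nrm A (x \<ominus> y)"
    if xy: "x \<in> carrier A" "y \<in> carrier A" for x y
  proof -
    have "(1/k) \<odot> (T x \<ominus> z) \<ominus> (1/k) \<odot> (T y \<ominus> z) = (1/k) \<odot> T (x \<ominus> y)"
      using xy h z by (simp add: T_def expand a_ac)
    then show ?thesis
      using Tle[of "x \<ominus> y"] xy e c by (simp add: nrm_smult Tc k norm_divide divide_right_mono)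
  qed
  have cl: "closedin M.mtopology (carrier A)" by (simp add: closedin_iff_approx)
  obtain y where y: "y \<in> carrier A" "(1/k) \<odot> (T y \<ominus> z) = y"
    by (rule contraction_fixed_point[OF cl, of "\<lambda>y. (1/k) \<odot> (T y \<ominus> z)" "s / (e + c)"])
       (use lip Tc z s e c in auto)
  have "T y \<ominus> z = k \<odot> ((1/k) \<odot> (T y \<ominus> z))"
    using Tc[OF y(1)] z k by (subst smult_smult) simp_all
  then have "T y = k \<odot> y \<oplus> z"
    using minus_add_cancel[of "T y" z] Tc y z by simp
  also have "k \<odot> y = (\<i> * complex_of_real e) \<odot> y \<oplus> (\<i> * complex_of_real c) \<odot> y"
    using smult_add_left[OF y(1), of "\<i> * complex_of_real e" "\<i> * complex_of_real c"]
    by (simp add: k_def ring_distribs)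
  finally have "h \<otimes> y \<oplus> (\<i> * complex_of_real c) \<odot> y
      = (z \<oplus> (\<i> * complex_of_real e) \<odot> y) \<oplus> (\<i> * complex_of_real c) \<odot> y"
    using y z by (simp add: T_def a_ac)
  then have "h \<otimes> y = z \<oplus> (\<i> * complex_of_real e) \<odot> y"
    using y z h by simp
  then show thesis using that y by blast
qed

text \<open>Adding \<open>\<i>c y\<close> on both sides gives \<open>(e + c) \<bar>y\<bar> \<le> \<bar>z\<bar> + sqrt (\<bar>h\<bar>\<^sup>2 + c\<^sup>2) \<bar>y\<bar>\<close>, where bars denote norms. Since
  \<open>sqrt (\<bar>h\<bar>\<^sup>2 + c\<^sup>2) - c\<close> tends to zero as \<open>c\<close> grows, the claim follows in the limit.\<close>

lemma resolvent_bound: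
  assumes h: "h \<in> carrier A" "star A h = h" and e: "e > 0" and z: "z \<in> carrier A"
    and y: "y \<in> carrier A" and eq: "h \<otimes> y = z \<oplus> (\<i> * complex_of_real e) \<odot> y"
  shows "e * nrm A y \<le> nrm A z"
proof (rule field_le_epsilon)
  fix d :: real assume d: "d > 0"
  define K where "K = (nrm A h)\<^sup>2 * nrm A y"
  have K: "K \<ge> 0" using y h by (simp add: K_def nrm_nonneg)
  \<comment> \<open>With this \<open>c\<close> the error term \<open>K / (2 c)\<close> is at most \<open>d\<close>.\<close>
  define c where "c = (K + 1) / (2 * d)"
  have c: "c > 0" using d K by (simp add: c_def)
  define s where "s = sqrt ((nrm A h)\<^sup>2 + c\<^sup>2)"
  have s_le: "s \<le> c + (nrm A h)\<^sup>2 / (2 * c)"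
  proof -
    have "c * ((nrm A h)\<^sup>2 / (2 * c)) = (nrm A h)\<^sup>2 / 2" using c by (simp add: field_simps)
    with c have "(nrm A h)\<^sup>2 + c\<^sup>2 \<le> (c + (nrm A h)\<^sup>2 / (2 * c))\<^sup>2"
      by (simp add: power2_sum)
    then show ?thesis unfolding s_def using c by (intro real_le_lsqrt) auto
  qed
  define T where "T = h \<otimes> y \<oplus> (\<i> * complex_of_real c) \<odot> y"
  have T: "T \<in> carrier A" using h y by (simp add: T_def)
  have Tle: "nrm A T \<le> s * nrm A y"
  proof (rule power2_le_imp_le)
    show "(nrm A T)\<^sup>2 \<le> (s * nrm A y)\<^sup>2"
      using nrm_shift[OF h y, of c] by (simp add: T_def s_def power_mult_distrib)
  qed (use nrm_nonneg y s_def in simp)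
  have "T = z \<oplus> (\<i> * complex_of_real (e + c)) \<odot> y"
    using y z by (simp add: T_def eq ring_distribs smult_add_left a_ac)
  then have "(\<i> * complex_of_real (e + c)) \<odot> y = T \<ominus> z"
    using y z by (simp add: minus_eq_smult a_inv_eq_smult[symmetric] a_ac r_neg1 r_neg2)
  then have "(e + c) * nrm A y = nrm A (T \<ominus> z)"
    using nrm_smult[OF y, of "\<i> * complex_of_real (e + c)"] e c 
    by (simp add: norm_mult del: of_real_add)
  also have "\<dots> \<le> s * nrm A y + nrm A z" using nrm_minus_le[OF T z] Tle by linarith
  also have "\<dots> \<le> (c + (nrm A h)\<^sup>2 / (2 * c)) * nrm A y + nrm A z"
    using s_le y by (simp add: nrm_nonneg mult_right_mono)
  finally have "e * nrm A y \<le> nrm A z + K / (2 * c)"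
    by (simp add: K_def algebra_simps)
  also have "K / (2 * c) \<le> d" using d K by (simp add: c_def field_simps)
  finally show "e * nrm A y \<le> nrm A z + d" by simp
qed

text \<open>The element \<open>u = h (h - \<i>e)\<^sup>-\<^sup>1\<close> acts as an approximate right unit for \<open>x\<close> when \<open>h = x\<^sup>*x\<close>. By the resolvent
  bound, multiplication by \<open>1 - u = -\<i>e (h - \<i>e)\<^sup>-\<^sup>1\<close> does not increase norms, so \<open>u\<close> has norm at most 2; as
  \<open>h (1 - u) = -\<i>e u\<close>, the square of the norm of \<open>x (1 - u)\<close> is the norm of
  \<open>(1 - u)\<^sup>* h (1 - u) = -\<i>e (u - u\<^sup>*u)\<close>, hence at most \<open>6 e\<close>. The equation for \<open>u\<close> is part of the conclusion
  because it shows that \<open>u\<close> lies in every two-sided ideal that contains \<open>h\<close>.\<close>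

lemma approximate_unit:
  assumes x: "x \<in> carrier A" and d: "d > 0" and h_def: "h = star A x \<otimes> x"
  obtains u and e :: real where "u \<in> carrier A" "e > 0" "h \<otimes> u = h \<oplus> (\<i> * complex_of_real e) \<odot> u"
    "nrm A (x \<ominus> x \<otimes> u) < d"
proof -
  \<comment> \<open>Any \<open>e\<close> with \<open>6 e < d\<^sup>2\<close> will do.\<close>
  define e where "e = d\<^sup>2 / 7"
  have e: "e > 0" using d by (simp add: e_def)
  define l where "l = \<i> * complex_of_real e"
  have l: "cmod l = e" using e by (simp add: l_def norm_mult)
  have h: "h \<in> carrier A" "star A h = h" using x by (simp_all add: h_def expand)
  obtain u where u: "u \<in> carrier A" and eq: "h \<otimes> u = h \<oplus> l \<odot> u"
    using resolvent_exists[OF h e h(1)] unfolding l_def by blast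
  have u2: "nrm A (u \<otimes> w) \<le> 2 * nrm A w" if w: "w \<in> carrier A" for w
  proof -
    have "h \<otimes> (w \<ominus> u \<otimes> w) = h \<otimes> w \<oplus> (-1) \<odot> ((h \<otimes> u) \<otimes> w)"
      using h u w by (simp add: expand)
    also have "\<dots> = h \<otimes> w \<oplus> ((- 1) \<odot> (h \<otimes> w) \<oplus> (- l) \<odot> (u \<otimes> w))"
      unfolding eq using h u w by (simp add: expand)
    also have "\<dots> = (- l) \<odot> (u \<otimes> w)"
      using smult_cancel_l(1)[of "h \<otimes> w" "(- l) \<odot> (u \<otimes> w)" 1] h u w by simp
    also have "\<dots> = (- l) \<odot> w \<oplus> l \<odot> (w \<ominus> u \<otimes> w)"
      using h u w by (simp add: expand)
    finally have "e * nrm A (w \<ominus> u \<otimes> w) \<le> nrm A ((- l) \<odot> w)"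
      using h u w unfolding l_def by (intro resolvent_bound[OF h e]) auto
    then have "nrm A (w \<ominus> u \<otimes> w) \<le> nrm A w" using w e by (simp add: nrm_smult l)
    moreover have "nrm A (u \<otimes> w) = nrm A (w \<ominus> (w \<ominus> u \<otimes> w))"
      using u w smult_cancel_l(1)[of w "u \<otimes> w" 1] by (simp add: expand)
    ultimately show ?thesis using nrm_minus_le[of w "w \<ominus> u \<otimes> w"] u w by simp
  qed
  have "(nrm A u)\<^sup>2 \<le> 2 * nrm A u"
    using u2[of "star A u"] cstar_identity[of "star A u"] u by (simp add: star_star)
  then have nu: "nrm A u \<le> 2"
    using nrm_nonneg[OF u] by (cases "nrm A u = 0") (auto simp: power2_eq_square)
  have hu: "h \<ominus> h \<otimes> u = (- l) \<odot> u"
    unfolding eq using h u smult_cancel_l(1)[of h "(- l) \<odot> u" 1] by (simp add: expand)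
  have "star A (x \<ominus> x \<otimes> u) \<otimes> (x \<ominus> x \<otimes> u) = (h \<ominus> h \<otimes> u) \<ominus> star A u \<otimes> (h \<ominus> h \<otimes> u)"
    using x u by (simp add: h_def expand a_ac)
  also have "\<dots> = (- l) \<odot> (u \<ominus> star A u \<otimes> u)"
    unfolding hu using u by (simp add: expand)
  finally have "(nrm A (x \<ominus> x \<otimes> u))\<^sup>2 = e * nrm A (u \<ominus> star A u \<otimes> u)"
    using cstar_identity[of "x \<ominus> x \<otimes> u"] x u by (simp add: nrm_smult l)
  also have "\<dots> \<le> e * (2 + 2 * 2)"
    using nrm_minus_le[of u "star A u \<otimes> u"] cstar_identity[OF u] nu u e
      mult_mono[OF nu nu] nrm_nonneg[OF u]
    by (intro mult_left_mono) (auto simp: power2_eq_square)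
  also have "\<dots> < d\<^sup>2" using d by (simp add: e_def)
  finally have "nrm A (x \<ominus> x \<otimes> u) < d"
    using d by (simp add: power2_less_imp_less)
  then show thesis using that u e eq unfolding l_def by blast
qed


section \<open>Contractivity of *-homomorphisms\<close>

lemma eq_if_arbitrarily_close:
  assumes x: "x \<in> carrier A" and y: "y \<in> carrier A"
    and le: "\<And>e. e > 0 \<Longrightarrow> nrm A (x \<ominus> y) \<le> C * e"
  shows "x = y"
proof -
  have "nrm A (x \<ominus> y) = 0"
  proof (rule ccontr)
    assume "nrm A (x \<ominus> y) \<noteq> 0"
    then have n: "nrm A (x \<ominus> y) > 0"
      using nrm_nonneg[of "x \<ominus> y"] x y by (simp add: less_le)
    define K where "K = \<bar>C\<bar> + 1"
    have K: "K > 0" "C \<le> K" by (auto simp: K_def)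
    define e where "e = nrm A (x \<ominus> y) / (2 * K)"
    have e: "e > 0" using n K(1) by (simp add: e_def)
    have "nrm A (x \<ominus> y) \<le> C * e" using le e by blast
    also have "\<dots> \<le> K * e" using K(2) e by (intro mult_right_mono) simp_all
    also have "\<dots> = nrm A (x \<ominus> y) / 2" using K(1) by (simp add: e_def)
    finally show False using n by simp
  qed
  then show ?thesis using x y by (simp add: nrm_eq_0_iff minus_eq_zero_iff)
qed

lemma add_minus_add_right:
  assumes "a \<in> carrier A" "b \<in> carrier A" "c \<in> carrier A"
  shows "(a \<oplus> c) \<ominus> (b \<oplus> c) = a \<ominus> b"
proof -
  have "(a \<oplus> c) \<ominus> (b \<oplus> c) = c \<oplus> ((-1) \<odot> c \<oplus> (a \<oplus> (-1) \<odot> b))"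
    using assms by (simp add: expand a_ac)
  then show ?thesis
    using assms smult_cancel_l(1)[of c "a \<oplus> (-1) \<odot> b" 1] by (simp add: minus_eq_smult)
qed

text \<open>This set is the domain of the contraction in the next lemma.\<close>

lemma closedin_selfadjoint_commutant:
  assumes h: "h \<in> carrier A"
  shows "closedin M.mtopology {r \<in> carrier A. nrm A r \<le> C \<and> star A r = r \<and> r \<otimes> h = h \<otimes> r}"
    (is "closedin _ ?S")
  unfolding closedin_iff_approx
proof (intro conjI ballI impI)
  fix x assume x: "x \<in> carrier A" and "\<forall>e>0. \<exists>y\<in>?S. nrm A (x \<ominus> y) < e"
  then have app: "\<exists>y\<in>?S. nrm A (x \<ominus> y) < e" if "e > 0" for e using that by blast
  have "nrm A x \<le> C"
  proof (rule field_le_epsilon)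
    fix e :: real assume "e > 0"
    then obtain y where y: "y \<in> ?S" "nrm A (x \<ominus> y) < e" using app by blast
    then show "nrm A x \<le> C + e"
      using nrm_triangle[of "x \<ominus> y" y] x minus_add_cancel[of x y] by simp
  qed
  moreover have "star A x = x"
  proof (rule eq_if_arbitrarily_close)
    fix e :: real assume "e > 0"
    then obtain y where y: "y \<in> ?S" "nrm A (x \<ominus> y) < e" using app by blast
    have "star A x \<ominus> x = star A (x \<ominus> y) \<oplus> (y \<ominus> x)"
      using x y minus_add_minus[of "star A x" y x] by (simp add: expand)
    then show "nrm A (star A x \<ominus> x) \<le> 2 * e"
      using nrm_triangle[of "star A (x \<ominus> y)" "y \<ominus> x"] x y nrm_minus_swap[of x y] by simp
  qed (use x in auto)
  moreover have "x \<otimes> h = h \<otimes> x"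
  proof (rule eq_if_arbitrarily_close)
    fix e :: real assume "e > 0"
    then obtain y where y: "y \<in> ?S" "nrm A (x \<ominus> y) < e" using app by blast
    have 1: "x \<otimes> h \<ominus> h \<otimes> x = (x \<ominus> y) \<otimes> h \<ominus> h \<otimes> (x \<ominus> y)"
      using x y h smult_cancel_l(2)[of "h \<otimes> y" "(- 1) \<odot> (h \<otimes> x)" 1] by (simp add: expand a_ac)
    have "nrm A ((x \<ominus> y) \<otimes> h) \<le> e * nrm A h" "nrm A (h \<otimes> (x \<ominus> y)) \<le> nrm A h * e"
      using x y h nrm_mult[of "x \<ominus> y" h] nrm_mult[of h "x \<ominus> y"] nrm_nonneg[OF h]
        mult_right_mono[of "nrm A (x \<ominus> y)" e "nrm A h"]
        mult_left_mono[of "nrm A (x \<ominus> y)" e "nrm A h"] by auto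
    then show "nrm A (x \<otimes> h \<ominus> h \<otimes> x) \<le> (2 * nrm A h) * e"
      unfolding 1 using nrm_minus_le[of "(x \<ominus> y) \<otimes> h" "h \<otimes> (x \<ominus> y)"] x y h
      by (simp add: mult.commute)
  qed (use x h in auto)
  ultimately show "x \<in> ?S" using x by simp
qed auto

text \<open>With \<open>r = 1 - sqrt (1 - h\<^sup>2)\<close> the equation says \<open>(1 - r)\<^sup>2 = 1 - h\<^sup>2\<close>; in this form it makes sense without a
  unit. The solution is the fixed point of \<open>r \<mapsto> (r\<^sup>2 + h\<^sup>2) / 2\<close>, which on the ball of radius \<open>nrm A h\<close> is a
  contraction with factor \<open>nrm A h < 1\<close>.\<close>

lemma selfadjoint_complement_root:
  assumes h: "h \<in> carrier A" "star A h = h" and lt: "nrm A h < 1"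
  obtains r where "r \<in> carrier A" "star A r = r" "r \<otimes> h = h \<otimes> r" "r \<oplus> r = r \<otimes> r \<oplus> h \<otimes> h"
proof -
  let ?S = "{r \<in> carrier A. nrm A r \<le> nrm A h \<and> star A r = r \<and> r \<otimes> h = h \<otimes> r}"
  define f where "f r = (1/2) \<odot> (r \<otimes> r \<oplus> h \<otimes> h)" for r
  have hr: "r \<otimes> (h \<otimes> z) = h \<otimes> (r \<otimes> z)" if "r \<in> ?S" "z \<in> carrier A" for r z
    using that h by (simp flip: mult_assoc)
  have fS: "f r \<in> ?S" if r: "r \<in> ?S" for r
  proof -
    have rc: "r \<in> carrier A" "nrm A r \<le> nrm A h" "0 \<le> nrm A r" "0 \<le> nrm A h"
      using r h nrm_nonneg by auto
    have "nrm A (r \<otimes> r) \<le> nrm A r * nrm A r" using rc nrm_mult by blast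
    also have "\<dots> \<le> nrm A h * 1" using rc lt by (intro mult_mono) auto
    finally have 1: "nrm A (r \<otimes> r) \<le> nrm A h" by simp
    have "nrm A (h \<otimes> h) \<le> nrm A h * nrm A h" using h nrm_mult by blast
    also have "\<dots> \<le> nrm A h * 1" using rc lt by (intro mult_mono) auto
    finally have "nrm A (h \<otimes> h) \<le> nrm A h" by simp
    with 1 have "nrm A (f r) \<le> nrm A h"
      using nrm_triangle[of "r \<otimes> r" "h \<otimes> h"] r h by (simp add: f_def nrm_smult)
    moreover have "f r \<otimes> h = h \<otimes> f r"
      using r h hr[OF r] by (simp add: f_def expand)
    ultimately show ?thesis using r h by (simp add: f_def expand)
  qed
  have lip: "nrm A (f x \<ominus> f y) \<le> nrm A h * nrm A (x \<ominus> y)" if x: "x \<in> ?S" and y: "y \<in> ?S" for x y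
  proof -
    have c: "x \<in> carrier A" "y \<in> carrier A" "nrm A x \<le> nrm A h" "nrm A y \<le> nrm A h"
      using x y by auto
    have "f x \<ominus> f y = (1/2) \<odot> (x \<otimes> x) \<ominus> (1/2) \<odot> (y \<otimes> y)"
      unfolding f_def using c(1,2) h(1) by (simp add: smult_add_right add_minus_add_right)
    also have "\<dots> = (1/2) \<odot> (x \<otimes> (x \<ominus> y) \<oplus> (x \<ominus> y) \<otimes> y)"
      using c(1,2) by (simp add: expand a_assoc)
    finally have "f x \<ominus> f y = (1/2) \<odot> (x \<otimes> (x \<ominus> y) \<oplus> (x \<ominus> y) \<otimes> y)" .
    moreover have "nrm A (x \<otimes> (x \<ominus> y)) \<le> nrm A h * nrm A (x \<ominus> y)"
      by (rule order.trans[OF nrm_mult]) (use c nrm_nonneg in \<open>auto intro: mult_right_mono\<close>)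
    moreover have "nrm A ((x \<ominus> y) \<otimes> y) \<le> nrm A h * nrm A (x \<ominus> y)"
      using nrm_mult[of "x \<ominus> y" y] mult_left_mono[OF c(4) nrm_nonneg[of "x \<ominus> y"]] c
      by (simp add: mult.commute)
    ultimately show ?thesis
      using nrm_triangle[of "x \<otimes> (x \<ominus> y)" "(x \<ominus> y) \<otimes> y"] c by (simp add: nrm_smult)
  qed
  obtain r where r: "r \<in> ?S" "f r = r"
    by (rule contraction_fixed_point[OF closedin_selfadjoint_commutant[OF h(1), of "nrm A h"],
          of f "nrm A h"]) (use fS lip lt h in auto)
  have "r \<otimes> r \<oplus> h \<otimes> h = 2 \<odot> f r"
    unfolding f_def using r h by (subst smult_smult) simp_all
  also have "\<dots> = r \<oplus> r"
    using r smult_add_left[of r 1 1] by simp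
  finally show thesis using that[of r] r by simp
qed

text \<open>The hypotheses say that \<open>v = k + \<i>(1 - r)\<close> is unitary: \<open>v\<^sup>*v = k\<^sup>2 + (1 - r)\<^sup>2 = 1\<close>. As \<open>k\<close> is the real part of
  \<open>v\<close>, its norm is at most 1. Since there need not be a unit, \<open>v\<close> and \<open>v\<^sup>*\<close> are only applied to the element \<open>k\<close>,
  where they act isometrically. The hypotheses are algebraic and therefore survive under homomorphisms.\<close>

lemma nrm_le_1_if_complement_root:
  assumes k: "k \<in> carrier A" "star A k = k" and r: "r \<in> carrier A" "star A r = r"
    and rk: "r \<otimes> k = k \<otimes> r" and eq: "r \<oplus> r = r \<otimes> r \<oplus> k \<otimes> k"
  shows "nrm A k \<le> 1"
proof -
  \<comment> \<open>The element \<open>v k\<close> is \<open>k\<^sup>2 + \<i>q\<close>, and \<open>v\<^sup>* k\<close> is \<open>k\<^sup>2 - \<i>q\<close>; their sum is \<open>2 k\<^sup>2\<close>.\<close>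
  define q where "q = k \<ominus> r \<otimes> k"
  let ?w = "k \<otimes> (k \<otimes> r)"
  have q: "q \<in> carrier A" using k r by (simp add: q_def)
  have rk': "r \<otimes> (k \<otimes> z) = k \<otimes> (r \<otimes> z)" if "z \<in> carrier A" for z
    using that k r rk by (simp flip: mult_assoc)
  have sq: "star A q = q" using k r rk by (simp add: q_def expand)
  have comm: "k \<otimes> k \<otimes> q = q \<otimes> (k \<otimes> k)" using k r by (simp add: q_def expand rk rk')
  have e1: "k \<otimes> (k \<otimes> (k \<otimes> k)) \<oplus> k \<otimes> (k \<otimes> (r \<otimes> r)) = ?w \<oplus> ?w"
  proof -
    have "?w \<oplus> ?w = k \<otimes> (k \<otimes> (r \<oplus> r))" using k r by (simp add: expand)
    also have "\<dots> = k \<otimes> (k \<otimes> (k \<otimes> k)) \<oplus> k \<otimes> (k \<otimes> (r \<otimes> r))"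
      unfolding eq using k r by (simp add: expand a_ac)
    finally show ?thesis by simp
  qed
  have "(k \<otimes> k) \<otimes> (k \<otimes> k) \<oplus> q \<otimes> q
      = k \<otimes> k \<oplus> ((k \<otimes> (k \<otimes> (k \<otimes> k)) \<oplus> k \<otimes> (k \<otimes> (r \<otimes> r))) \<oplus> ((-1) \<odot> ?w \<oplus> (-1) \<odot> ?w))"
    using k r by (simp add: q_def expand rk rk' a_ac)
  also have "\<dots> = k \<otimes> k \<oplus> ((1 \<odot> ?w \<oplus> (-1) \<odot> ?w) \<oplus> (1 \<odot> ?w \<oplus> (-1) \<odot> ?w))"
    unfolding e1 using k r by (simp add: a_ac)
  also have "\<dots> = k \<otimes> k"
    using k r by (subst (1 2) smult_cancel) simp_all
  finally have sum: "(k \<otimes> k) \<otimes> (k \<otimes> k) \<oplus> q \<otimes> q = k \<otimes> k" .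
  have kk: "nrm A (k \<otimes> k) = (nrm A k)\<^sup>2" using cstar_identity[of k] k by simp
  have "(nrm A (k \<otimes> k \<oplus> \<i> \<odot> q))\<^sup>2 = (nrm A k)\<^sup>2"
    using nrm_add_imaginary[of "k \<otimes> k" q] k q by (simp add: star_mult sq comm sum kk)
  moreover have "(nrm A (k \<otimes> k \<oplus> \<i> \<odot> ((-1) \<odot> q)))\<^sup>2 = (nrm A k)\<^sup>2"
  proof -
    have "star A (k \<otimes> k) \<otimes> ((-1) \<odot> q) = star A ((-1) \<odot> q) \<otimes> (k \<otimes> k)"
      using k q by (simp add: star_mult star_smult smult_mult_left smult_mult_right sq comm)
    moreover have "star A ((-1) \<odot> q) \<otimes> ((-1) \<odot> q) = q \<otimes> q"
      using q by (simp add: star_smult smult_mult_left smult_mult_right sq smult_smult)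
    ultimately show ?thesis
      using nrm_add_imaginary[of "k \<otimes> k" "(-1) \<odot> q"] k q by (simp add: star_mult sum kk)
  qed
  ultimately have n: "nrm A (k \<otimes> k \<oplus> \<i> \<odot> q) = nrm A k"
    "nrm A (k \<otimes> k \<oplus> \<i> \<odot> ((-1) \<odot> q)) = nrm A k"
    using k q nrm_nonneg by (simp_all add: power2_eq_iff_nonneg)
  have "2 \<odot> (k \<otimes> k) = k \<otimes> k \<oplus> (k \<otimes> k \<oplus> (\<i> \<odot> q \<oplus> (-\<i>) \<odot> q))"
    using k q smult_add_left[of "k \<otimes> k" 1 1] by simp
  also have "\<dots> = (k \<otimes> k \<oplus> \<i> \<odot> q) \<oplus> (k \<otimes> k \<oplus> \<i> \<odot> ((-1) \<odot> q))"
    using k q by (simp add: smult_smult a_ac del: smult_cancel)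
  finally have "2 * nrm A (k \<otimes> k) = nrm A ((k \<otimes> k \<oplus> \<i> \<odot> q) \<oplus> (k \<otimes> k \<oplus> \<i> \<odot> ((-1) \<odot> q)))"
    using nrm_smult[of "k \<otimes> k" 2] k by simp
  also have "\<dots> \<le> nrm A k + nrm A k"
    using nrm_triangle[of "k \<otimes> k \<oplus> \<i> \<odot> q" "k \<otimes> k \<oplus> \<i> \<odot> ((-1) \<odot> q)"] k q n by simp
  finally have "nrm A k * nrm A k \<le> 1 * nrm A k" by (simp add: kk power2_eq_square)
  then show ?thesis using nrm_nonneg[OF k(1)] by (cases "nrm A k = 0") auto
qed

end

definition star_hom :: "('a, 'c) cstar_scheme \<Rightarrow> ('b, 'd) cstar_scheme \<Rightarrow> ('a \<Rightarrow> 'b) \<Rightarrow> bool"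
  where "star_hom A B f \<longleftrightarrow>
     f ` carrier A \<subseteq> carrier B \<and>
     (\<forall>x\<in>carrier A. \<forall>y\<in>carrier A. f (x \<oplus>\<^bsub>A\<^esub> y) = f x \<oplus>\<^bsub>B\<^esub> f y) \<and>
     (\<forall>c. \<forall>x\<in>carrier A. f (c \<odot>\<^bsub>A\<^esub> x) = c \<odot>\<^bsub>B\<^esub> f x) \<and>
     (\<forall>x\<in>carrier A. \<forall>y\<in>carrier A. f (x \<otimes>\<^bsub>A\<^esub> y) = f x \<otimes>\<^bsub>B\<^esub> f y) \<and>
     (\<forall>x\<in>carrier A. f (star A x) = star B (f x))"

lemma star_homD:
  assumes "star_hom A B f" "x \<in> carrier A"
  shows "f x \<in> carrier B" "f (c \<odot>\<^bsub>A\<^esub> x) = c \<odot>\<^bsub>B\<^esub> f x" "f (star A x) = star B (f x)"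
    and "y \<in> carrier A \<Longrightarrow> f (x \<oplus>\<^bsub>A\<^esub> y) = f x \<oplus>\<^bsub>B\<^esub> f y"
    and "y \<in> carrier A \<Longrightarrow> f (x \<otimes>\<^bsub>A\<^esub> y) = f x \<otimes>\<^bsub>B\<^esub> f y"
  using assms by (auto simp: star_hom_def)

locale cstar_hom = A: cstar_algebra A + B: cstar_algebra B
  for A :: "('a, 'c) cstar_scheme" and B :: "('b, 'd) cstar_scheme" and f +
  assumes hom: "star_hom A B f"
begin

lemmas hom_simps = star_homD[OF hom]

lemma hom_zero: "f \<zero>\<^bsub>A\<^esub> = \<zero>\<^bsub>B\<^esub>"
  using hom_simps(2)[of "\<zero>\<^bsub>A\<^esub>" 0] hom_simps(1)[of "\<zero>\<^bsub>A\<^esub>"] by simp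

lemma hom_minus:
  "\<lbrakk>x \<in> carrier A; y \<in> carrier A\<rbrakk> \<Longrightarrow> f (x \<ominus>\<^bsub>A\<^esub> y) = f x \<ominus>\<^bsub>B\<^esub> f y"
  by (simp add: A.minus_eq_smult B.minus_eq_smult hom_simps)

text \<open>For a scaled self-adjoint element \<open>k\<close> of norm below 1, the image of the element \<open>r\<close> that complements \<open>k\<close> to a
  unitary complements \<open>f k\<close> to a unitary, so \<open>f k\<close> has norm at most 1.\<close>

lemma contractive_selfadjoint:
  assumes h: "h \<in> carrier A" "star A h = h"
  shows "nrm B (f h) \<le> nrm A h"
proof (rule field_le_epsilon)
  fix d :: real assume d: "d > 0"
  define t where "t = 1 / (nrm A h + d)"
  have t: "t > 0" using d A.nrm_nonneg[OF h(1)] by (simp add: t_def)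
  define k where "k = complex_of_real t \<odot>\<^bsub>A\<^esub> h"
  have k: "k \<in> carrier A" "star A k = k" using h by (simp_all add: k_def A.star_smult)
  have "nrm A k < 1" using h t d A.nrm_nonneg[OF h(1)] by (simp add: k_def A.nrm_smult) (simp add: t_def)
  then obtain r where r: "r \<in> carrier A" "star A r = r" "r \<otimes>\<^bsub>A\<^esub> k = k \<otimes>\<^bsub>A\<^esub> r"
    "r \<oplus>\<^bsub>A\<^esub> r = r \<otimes>\<^bsub>A\<^esub> r \<oplus>\<^bsub>A\<^esub> k \<otimes>\<^bsub>A\<^esub> k"
    using A.selfadjoint_complement_root[OF k] by metis
  have "nrm B (f k) \<le> 1"
  proof (rule B.nrm_le_1_if_complement_root)
    show "f r \<otimes>\<^bsub>B\<^esub> f k = f k \<otimes>\<^bsub>B\<^esub> f r" using arg_cong[OF r(3), of f] unfolding hom_simps(5)[OF r(1) k(1)] hom_simps(5)[OF k(1) r(1)] .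
    show "f r \<oplus>\<^bsub>B\<^esub> f r = f r \<otimes>\<^bsub>B\<^esub> f r \<oplus>\<^bsub>B\<^esub> f k \<otimes>\<^bsub>B\<^esub> f k"
      using arg_cong[OF r(4), of f] r(1) k(1)
      unfolding hom_simps(4)[OF r(1) r(1)] by (simp add: hom_simps(4,5))
  qed (use r k hom_simps(3)[of k] hom_simps(3)[of r] in \<open>simp_all add: hom_simps(1)\<close>)
  moreover have "nrm B (f k) = t * nrm B (f h)"
    using h t by (simp add: k_def hom_simps B.nrm_smult)
  ultimately show "nrm B (f h) \<le> nrm A h + d"
    using t d A.nrm_nonneg[OF h(1)] by (simp add: t_def divide_simps split: if_splits)
qed

lemma contractive:
  assumes x: "x \<in> carrier A"
  shows "nrm B (f x) \<le> nrm A x"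
proof (rule power2_le_imp_le)
  have "(nrm B (f x))\<^sup>2 = nrm B (f (star A x \<otimes>\<^bsub>A\<^esub> x))"
    using x B.cstar_identity[of "f x"] by (simp add: hom_simps)
  also have "\<dots> \<le> nrm A (star A x \<otimes>\<^bsub>A\<^esub> x)"
    using x by (intro contractive_selfadjoint) (simp_all add: A.expand)
  finally show "(nrm B (f x))\<^sup>2 \<le> (nrm A x)\<^sup>2" using x by (simp add: A.cstar_identity)
qed (use x A.nrm_nonneg in simp)

end

section \<open>Closed ideals\<close>

lemma cstar_ideals_iff:
  assumes "cstar_algebra A"
  shows "I \<in> cstar_ideals A \<longleftrightarrow> I \<subseteq> carrier A \<and> \<zero>\<^bsub>A\<^esub> \<in> I \<and>
     (\<forall>x\<in>I. \<forall>y\<in>I. x \<oplus>\<^bsub>A\<^esub> y \<in> I) \<and> (\<forall>c. \<forall>x\<in>I. c \<odot>\<^bsub>A\<^esub> x \<in> I) \<and>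
     (\<forall>a\<in>carrier A. \<forall>x\<in>I. a \<otimes>\<^bsub>A\<^esub> x \<in> I \<and> x \<otimes>\<^bsub>A\<^esub> a \<in> I) \<and>
     (\<forall>x\<in>carrier A. (\<forall>e>0. \<exists>y\<in>I. nrm A (x \<ominus>\<^bsub>A\<^esub> y) < e) \<longrightarrow> x \<in> I)"
proof -
  interpret cstar_algebra A by fact
  have "submodule I complex_ring A \<longleftrightarrow> I \<subseteq> carrier A \<and> \<zero>\<^bsub>A\<^esub> \<in> I \<and>
     (\<forall>x\<in>I. \<forall>y\<in>I. x \<oplus>\<^bsub>A\<^esub> y \<in> I) \<and> (\<forall>c. \<forall>x\<in>I. c \<odot>\<^bsub>A\<^esub> x \<in> I)" (is "?l \<longleftrightarrow> ?r")
  proof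
    assume ?l then show ?r using submoduleE[OF \<open>?l\<close>] subgroup.one_closed[OF submodule.axioms(1)[OF \<open>?l\<close>]]
      by auto
  next
    assume r: ?r
    then have "\<ominus>\<^bsub>A\<^esub> x \<in> I" if "x \<in> I" for x using that a_inv_eq_smult[of x] by auto
    then show ?l using r by (intro submoduleI) auto
  qed
  then show ?thesis by (auto simp: cstar_ideals_def closedin_iff_approx)
qed

lemma cstar_idealD:
  assumes "cstar_algebra A" "I \<in> cstar_ideals A"
  shows "I \<subseteq> carrier A" "\<zero>\<^bsub>A\<^esub> \<in> I"
    "\<And>x y. \<lbrakk>x \<in> I; y \<in> I\<rbrakk> \<Longrightarrow> x \<oplus>\<^bsub>A\<^esub> y \<in> I"
    "\<And>c x. x \<in> I \<Longrightarrow> c \<odot>\<^bsub>A\<^esub> x \<in> I"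
    "\<And>a x. \<lbrakk>a \<in> carrier A; x \<in> I\<rbrakk> \<Longrightarrow> a \<otimes>\<^bsub>A\<^esub> x \<in> I"
    "\<And>a x. \<lbrakk>a \<in> carrier A; x \<in> I\<rbrakk> \<Longrightarrow> x \<otimes>\<^bsub>A\<^esub> a \<in> I"
    "\<And>x. \<lbrakk>x \<in> carrier A; \<And>e. e > 0 \<Longrightarrow> \<exists>y\<in>I. nrm A (x \<ominus>\<^bsub>A\<^esub> y) < e\<rbrakk> \<Longrightarrow> x \<in> I"
  using assms(2) unfolding cstar_ideals_iff[OF assms(1)] by blast+

text \<open>The resolvent equation expresses the approximate unit \<open>u\<close> and its adjoint through \<open>h u\<close>, \<open>u\<^sup>* h\<close> and \<open>h\<close>,
  all of which lie in the ideal.\<close>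

lemma cstar_ideal_approximate_unit:
  assumes A: "cstar_algebra A" and I: "I \<in> cstar_ideals A" and x: "x \<in> I" and d: "d > 0"
  obtains u where "u \<in> I" "star A u \<in> I" "nrm A (x \<ominus>\<^bsub>A\<^esub> x \<otimes>\<^bsub>A\<^esub> u) < d"
proof -
  interpret cstar_algebra A by fact
  note ID = cstar_idealD[OF A I]
  have xc: "x \<in> carrier A" using x ID(1) by blast
  define h where "h = star A x \<otimes>\<^bsub>A\<^esub> x"
  have hI: "h \<in> I" using x xc ID(5) by (simp add: h_def)
  have hc: "h \<in> carrier A" "star A h = h" using xc by (simp_all add: h_def expand)
  obtain u e where u: "u \<in> carrier A" "e > 0"
    and eq: "h \<otimes>\<^bsub>A\<^esub> u = h \<oplus>\<^bsub>A\<^esub> (\<i> * complex_of_real e) \<odot>\<^bsub>A\<^esub> u"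
    and lt: "nrm A (x \<ominus>\<^bsub>A\<^esub> x \<otimes>\<^bsub>A\<^esub> u) < d"
    using approximate_unit[OF xc d h_def] by blast
  define l where "l = \<i> * complex_of_real e"
  have l: "l \<noteq> 0" using u by (simp add: l_def)
  \<comment> \<open>This covers both \<open>u\<close> and its adjoint, whose equation has the conjugate coefficient.\<close>
  have key: "v \<in> I" if v: "v \<in> carrier A" "w = h \<oplus>\<^bsub>A\<^esub> k \<odot>\<^bsub>A\<^esub> v" "w \<in> I" "k \<noteq> 0" for v w k
  proof -
    have "w \<oplus>\<^bsub>A\<^esub> (-1) \<odot>\<^bsub>A\<^esub> h = k \<odot>\<^bsub>A\<^esub> v"
      using v(1) hc smult_cancel_l(1)[of h "k \<odot>\<^bsub>A\<^esub> v" 1] unfolding v(2) by (simp add: a_ac)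
    then have "v = (1 / k) \<odot>\<^bsub>A\<^esub> (w \<oplus>\<^bsub>A\<^esub> (-1) \<odot>\<^bsub>A\<^esub> h)"
      using v(1,4) by (simp add: smult_smult)
    then show ?thesis using ID(3,4) v(3) hI by metis
  qed
  have "u \<in> I" using key[OF u(1) eq] ID(6) hI u(1) l by (simp add: l_def)
  moreover have "star A u \<in> I"
  proof (rule key)
    show "star A u \<otimes>\<^bsub>A\<^esub> h = h \<oplus>\<^bsub>A\<^esub> cnj l \<odot>\<^bsub>A\<^esub> star A u"
      using arg_cong[OF eq, of "star A"] u hc
      by (simp add: star_mult star_add star_smult l_def)
    show "star A u \<otimes>\<^bsub>A\<^esub> h \<in> I" using u hI ID(5) by simp
  qed (use u l in auto)
  ultimately show thesis using that lt by blast
qed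

text \<open>As \<open>x\<close> is a limit of elements \<open>x u\<close>, its adjoint is a limit of elements \<open>u\<^sup>* x\<^sup>*\<close> of the ideal.\<close>

lemma cstar_ideal_star:
  assumes A: "cstar_algebra A" and I: "I \<in> cstar_ideals A" and x: "x \<in> I"
  shows "star A x \<in> I"
proof -
  interpret cstar_algebra A by fact
  note ID = cstar_idealD[OF A I]
  have xc: "x \<in> carrier A" using x ID(1) by blast
  show ?thesis
  proof (rule ID(7))
    fix d :: real assume "d > 0"
    then obtain u where u: "u \<in> I" "star A u \<in> I" and lt: "nrm A (x \<ominus>\<^bsub>A\<^esub> x \<otimes>\<^bsub>A\<^esub> u) < d"
      using cstar_ideal_approximate_unit[OF A I x] by blast
    have uc: "u \<in> carrier A" using u ID(1) by blast
    have "star A x \<ominus>\<^bsub>A\<^esub> star A u \<otimes>\<^bsub>A\<^esub> star A x = star A (x \<ominus>\<^bsub>A\<^esub> x \<otimes>\<^bsub>A\<^esub> u)"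
      using xc uc by (simp add: expand)
    then have "nrm A (star A x \<ominus>\<^bsub>A\<^esub> star A u \<otimes>\<^bsub>A\<^esub> star A x) < d" using lt xc uc by simp
    then show "\<exists>y\<in>I. nrm A (star A x \<ominus>\<^bsub>A\<^esub> y) < d" using ID(6) u xc star_closed by blast
  qed (use xc in simp)
qed

lemma subalg_minus:
  assumes A: "cstar_algebra A" and I: "I \<in> cstar_ideals A" and x: "x \<in> I" "y \<in> I"
  shows "x \<ominus>\<^bsub>subalg A I\<^esub> y = x \<ominus>\<^bsub>A\<^esub> y"
proof -
  interpret cstar_algebra A by fact
  note ID = cstar_idealD[OF A I]
  have "submodule I complex_ring A" using I by (simp add: cstar_ideals_def)
  then interpret S: Module.module complex_ring "subalg A I"
    by (rule submodule.submodule_is_module) (rule module_axioms)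
  have c: "x \<in> carrier A" "y \<in> carrier A" using x ID(1) by auto
  have y': "\<ominus>\<^bsub>subalg A I\<^esub> y \<in> I" using S.a_inv_closed[of y] x by simp
  have "\<ominus>\<^bsub>subalg A I\<^esub> y \<oplus>\<^bsub>A\<^esub> y = \<zero>\<^bsub>A\<^esub>" using S.l_neg[of y] x by simp
  then have "\<ominus>\<^bsub>A\<^esub> y = \<ominus>\<^bsub>subalg A I\<^esub> y" using y' ID(1) c by (intro minus_equality) auto
  then show ?thesis by (simp add: a_minus_def)
qed

text \<open>Closed ideals are self-adjoint and complete; only the norm distance needs care, because subtraction in
  the subalgebra is defined by an inverse that is sought in the smaller carrier.\<close>

lemma cstar_algebra_subalg:
  assumes A: "cstar_algebra A" and I: "I \<in> cstar_ideals A"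
  shows "cstar_algebra (subalg A I)"
proof -
  interpret cstar_algebra A by fact
  note ID = cstar_idealD[OF A I]
  have cl: "closedin M.mtopology I" and sm: "submodule I complex_ring A"
    using I by (simp_all add: cstar_ideals_def)
  interpret S: Module.module complex_ring "subalg A I"
    using sm by (rule submodule.submodule_is_module) (rule module_axioms)
  interpret Sub: Submetric "carrier A" "nrm_dist A" I
    by unfold_locales (rule ID(1))
  have c: "x \<in> carrier A" if "x \<in> I" for x using that ID(1) by blast
  have dist: "nrm_dist (subalg A I) x y = nrm_dist A x y" if "x \<in> I" "y \<in> I" for x y
    using that c by (simp add: nrm_dist_def subalg_minus[OF A I])
  have ms: "Metric_space I (nrm_dist (subalg A I))"
    unfolding Metric_space_def
  proof (intro conjI allI impI)
    fix x y
    show "0 \<le> nrm_dist (subalg A I) x y"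
      using dist[of x y] by (cases "x \<in> I \<and> y \<in> I") (auto simp: nrm_dist_def[of "subalg A I"] M.nonneg)
    show "nrm_dist (subalg A I) x y = nrm_dist (subalg A I) y x"
      using dist[of x y] dist[of y x] M.commute[of x y]
      by (cases "x \<in> I \<and> y \<in> I") (auto simp: nrm_dist_def[of "subalg A I"])
  qed (use dist Sub.sub.zero Sub.sub.triangle in auto)
  have "Sub.sub.mcomplete" using Sub.closedin_mcomplete_imp_mcomplete cl complete by blast
  then have comp: "Metric_space.mcomplete I (nrm_dist (subalg A I))"
    unfolding Sub.sub.mcomplete_def Metric_space.mcomplete_def[OF ms]
      Sub.sub.MCauchy_def Metric_space.MCauchy_def[OF ms]
      Sub.sub.limit_metric_sequentially Metric_space.limit_metric_sequentially[OF ms]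
    using dist by (simp add: image_subset_iff) (smt (verit))
  show ?thesis
  proof (unfold_locales)
    show "Metric_space.mcomplete (carrier (subalg A I)) (nrm_dist (subalg A I))"
      using comp by simp
  qed (use c in \<open>auto simp: expand[unfolded minus_eq_smult] nrm_eq_0_iff nrm_nonneg nrm_smult nrm_mult
     nrm_triangle cstar_identity ID cstar_ideal_star[OF A I]\<close>)
qed

lemma carrier_in_cstar_ideals:
  assumes A: "cstar_algebra A" shows "carrier A \<in> cstar_ideals A"
proof -
  interpret cstar_algebra A by fact
  show ?thesis by (simp add: cstar_ideals_iff[OF A])
qed

lemma zero_in_cstar_ideals:
  assumes A: "cstar_algebra A" shows "{\<zero>\<^bsub>A\<^esub>} \<in> cstar_ideals A"
proof -
  interpret cstar_algebra A by fact
  have "x = \<zero>\<^bsub>A\<^esub>" if x: "x \<in> carrier A" "\<forall>e>0. nrm A (x \<ominus>\<^bsub>A\<^esub> \<zero>\<^bsub>A\<^esub>) < e" for x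
    by (rule eq_if_arbitrarily_close[where C = 1]) (use x in \<open>auto simp: less_imp_le\<close>)
  then show ?thesis by (auto simp: cstar_ideals_iff[OF A])
qed

lemma Inter_in_cstar_ideals:
  assumes A: "cstar_algebra A" and S: "S \<subseteq> cstar_ideals A" "S \<noteq> {}"
  shows "\<Inter>S \<in> cstar_ideals A"
proof -
  have ID: "I \<in> cstar_ideals A" if "I \<in> S" for I using that S by blast
  note D = cstar_idealD[OF A ID]
  show ?thesis
    unfolding cstar_ideals_iff[OF A]
  proof (intro conjI ballI allI impI)
    show "\<Inter>S \<subseteq> carrier A" using D(1) S(2) by blast
    fix x assume x: "x \<in> carrier A" "\<forall>e>0. \<exists>y\<in>\<Inter>S. nrm A (x \<ominus>\<^bsub>A\<^esub> y) < e"
    show "x \<in> \<Inter>S"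
    proof (intro InterI)
      fix I assume I: "I \<in> S"
      show "x \<in> I"
      proof (rule D(7)[OF I x(1)])
        fix e :: real assume "e > 0"
        then obtain y where "y \<in> \<Inter>S" "nrm A (x \<ominus>\<^bsub>A\<^esub> y) < e" using x(2) by blast
        then show "\<exists>y\<in>I. nrm A (x \<ominus>\<^bsub>A\<^esub> y) < e" using I by blast
      qed
    qed
  qed (auto simp only: Inter_iff intro: D(2-6))
qed

text \<open>If \<open>a\<close> is in \<open>A\<close> and \<open>x\<close> in \<open>K\<close>, then \<open>a x\<close> is a limit of products \<open>(a x) u\<close> with \<open>u\<close> in \<open>K\<close>; the first factor
  is in \<open>I\<close>, so the product is in the ideal \<open>K\<close> of \<open>I\<close>. The other side follows by taking adjoints.\<close>

lemma cstar_ideal_of_ideal: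
  assumes A: "cstar_algebra A" and I: "I \<in> cstar_ideals A" and K: "K \<in> cstar_ideals (subalg A I)"
  shows "K \<in> cstar_ideals A"
proof -
  interpret cstar_algebra A by fact
  note B = cstar_algebra_subalg[OF A I]
  note ID = cstar_idealD[OF A I]
  note KD = cstar_idealD[OF B K, simplified]
  have KI: "K \<subseteq> I" and Kc: "K \<subseteq> carrier A" using KD(1) ID(1) by auto
  have cl: "x \<in> K" if x: "x \<in> carrier A" "\<forall>e>0. \<exists>y\<in>K. nrm A (x \<ominus>\<^bsub>A\<^esub> y) < e" for x
  proof -
    have "x \<in> I" using x KI by (intro ID(7)) blast+
    moreover have "\<exists>y\<in>K. nrm A (x \<ominus>\<^bsub>subalg A I\<^esub> y) < e" if "e > 0" for e
      using x(2) that subalg_minus[OF A I \<open>x \<in> I\<close>] KI by (metis subsetD)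
    ultimately show ?thesis using KD(7) by blast
  qed
  have left: "a \<otimes>\<^bsub>A\<^esub> x \<in> K" if a: "a \<in> carrier A" and x: "x \<in> K" for a x
  proof (rule cl)
    have xc: "x \<in> carrier A" using x Kc by blast
    show "\<forall>e>0. \<exists>y\<in>K. nrm A (a \<otimes>\<^bsub>A\<^esub> x \<ominus>\<^bsub>A\<^esub> y) < e"
    proof (intro allI impI)
      fix e :: real assume e: "e > 0"
      define d where "d = e / (nrm A a + 1)"
      have na: "nrm A a \<ge> 0" using nrm_nonneg[OF a] .
      have d: "d > 0" using e na by (simp add: d_def)
      obtain u where u: "u \<in> K" and lt: "nrm A (x \<ominus>\<^bsub>subalg A I\<^esub> x \<otimes>\<^bsub>A\<^esub> u) < d"
        using cstar_ideal_approximate_unit[OF B K x d] by auto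
      have uc: "u \<in> carrier A" using u Kc by blast
      have xu: "x \<otimes>\<^bsub>A\<^esub> u \<in> I" using x KI uc ID(6) by blast
      have lt': "nrm A (x \<ominus>\<^bsub>A\<^esub> x \<otimes>\<^bsub>A\<^esub> u) < d" using lt subalg_minus[OF A I _ xu] x KI by auto
      have eq: "a \<otimes>\<^bsub>A\<^esub> x \<ominus>\<^bsub>A\<^esub> (a \<otimes>\<^bsub>A\<^esub> x) \<otimes>\<^bsub>A\<^esub> u = a \<otimes>\<^bsub>A\<^esub> (x \<ominus>\<^bsub>A\<^esub> x \<otimes>\<^bsub>A\<^esub> u)"
        using a xc uc by (simp add: expand)
      have "nrm A (a \<otimes>\<^bsub>A\<^esub> x \<ominus>\<^bsub>A\<^esub> (a \<otimes>\<^bsub>A\<^esub> x) \<otimes>\<^bsub>A\<^esub> u) \<le> nrm A a * nrm A (x \<ominus>\<^bsub>A\<^esub> x \<otimes>\<^bsub>A\<^esub> u)"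
        unfolding eq using a xc uc by (intro nrm_mult) auto
      also have "\<dots> \<le> nrm A a * d" using lt' na by (intro mult_left_mono) auto
      also have "\<dots> < (nrm A a + 1) * d" using d by (simp add: ring_distribs)
      also have "\<dots> = e" using na by (simp add: d_def)
      finally have "nrm A (a \<otimes>\<^bsub>A\<^esub> x \<ominus>\<^bsub>A\<^esub> (a \<otimes>\<^bsub>A\<^esub> x) \<otimes>\<^bsub>A\<^esub> u) < e" .
      moreover have "(a \<otimes>\<^bsub>A\<^esub> x) \<otimes>\<^bsub>A\<^esub> u \<in> K" using KD(5) u ID(5) a x KI by blast
      ultimately show "\<exists>y\<in>K. nrm A (a \<otimes>\<^bsub>A\<^esub> x \<ominus>\<^bsub>A\<^esub> y) < e" by blast
    qed
    show "a \<otimes>\<^bsub>A\<^esub> x \<in> carrier A" using a xc by simp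
  qed
  have star: "star A x \<in> K" if "x \<in> K" for x
    using cstar_ideal_star[OF B K that] by simp
  have right: "x \<otimes>\<^bsub>A\<^esub> a \<in> K" if a: "a \<in> carrier A" and x: "x \<in> K" for a x
  proof -
    have xc: "x \<in> carrier A" using x Kc by blast
    have "star A (star A a \<otimes>\<^bsub>A\<^esub> star A x) \<in> K" using a x by (intro star left) auto
    then show ?thesis using a xc by (simp add: star_mult star_star)
  qed
  show ?thesis
    unfolding cstar_ideals_iff[OF A]
    by (intro conjI ballI allI impI Kc KD(2-4) left right) (simp_all add: cl)
qed

lemma cstar_ideals_subalg_iff:
  assumes A: "cstar_algebra A" and I: "I \<in> cstar_ideals A"
  shows "K \<in> cstar_ideals (subalg A I) \<longleftrightarrow> K \<in> cstar_ideals A \<and> K \<subseteq> I"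
proof (intro iffI conjI)
  assume K: "K \<in> cstar_ideals (subalg A I)"
  show "K \<in> cstar_ideals A" by (rule cstar_ideal_of_ideal[OF A I K])
  show "K \<subseteq> I" using cstar_idealD(1)[OF cstar_algebra_subalg[OF A I] K] by simp
next
  assume K: "K \<in> cstar_ideals A \<and> K \<subseteq> I"
  note ID = cstar_idealD[OF A I]
  note KD = cstar_idealD[OF A conjunct1[OF K]]
  have "x \<in> K" if x: "x \<in> I" "\<forall>e>0. \<exists>y\<in>K. nrm A (x \<ominus>\<^bsub>subalg A I\<^esub> y) < e" for x
  proof (rule KD(7))
    show "x \<in> carrier A" using x ID(1) by blast
    show "\<exists>y\<in>K. nrm A (x \<ominus>\<^bsub>A\<^esub> y) < e" if "e > 0" for e
      using x(2) that subalg_minus[OF A I x(1)] K by (metis subsetD)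
  qed
  then show "K \<in> cstar_ideals (subalg A I)"
    unfolding cstar_ideals_iff[OF cstar_algebra_subalg[OF A I]]
    using KD(2-6) K ID(1) by auto
qed


text \<open>Closedness of the preimage is the point where contractivity of \<open>f\<close> is needed.\<close>

lemma vimage_in_cstar_ideals:
  assumes A: "cstar_algebra A" and B: "cstar_algebra B" and f: "star_hom A B f"
    and N: "N \<in> cstar_ideals B"
  shows "{x \<in> carrier A. f x \<in> N} \<in> cstar_ideals A"
proof -
  interpret cstar_hom A B f using A B f by (simp add: cstar_hom_def cstar_hom_axioms_def)
  note ND = cstar_idealD[OF B N]
  show ?thesis
    unfolding cstar_ideals_iff[OF A]
  proof (intro conjI ballI allI impI)
    fix x assume x: "x \<in> carrier A" "\<forall>e>0. \<exists>y\<in>{x \<in> carrier A. f x \<in> N}. nrm A (x \<ominus>\<^bsub>A\<^esub> y) < e"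
    have "f x \<in> N"
    proof (rule ND(7))
      fix e :: real assume "e > 0"
      then obtain y where y: "y \<in> carrier A" "f y \<in> N" "nrm A (x \<ominus>\<^bsub>A\<^esub> y) < e" using x(2) by blast
      then show "\<exists>y\<in>N. nrm B (f x \<ominus>\<^bsub>B\<^esub> y) < e"
        using contractive[of "x \<ominus>\<^bsub>A\<^esub> y"] hom_minus[of x y] x(1) by (intro bexI[of _ "f y"]) auto
    qed (use x hom_simps(1) in blast)
    then show "x \<in> {x \<in> carrier A. f x \<in> N}" using x by blast
  qed (use ND hom_simps hom_zero in auto)
qed

section \<open>Quotients as images of homomorphisms\<close>

text \<open>This eliminates cosets and the quotient norm: a quotient is known up to *-isomorphism by the
  surjective *-homomorphisms with the given kernel. In both directions the two maps determine each other by
  \<open>g (f x) = I + x\<close>.\<close>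

lemma quotient_iso_iff_hom:
  assumes A: "cstar_algebra A" and I: "I \<in> cstar_ideals A" and B: "cstar_algebra B"
  shows "star_isomorphic B (quotient A I) \<longleftrightarrow>
    (\<exists>f. star_hom A B f \<and> f ` carrier A = carrier B \<and> {x \<in> carrier A. f x = \<zero>\<^bsub>B\<^esub>} = I)"
proof -
  interpret A: cstar_algebra A by fact
  interpret B: cstar_algebra B by fact
  note ID = cstar_idealD[OF A I]
  let ?c = "\<lambda>x. I +>\<^bsub>A\<^esub> x"
  have cos: "?c x = {y \<in> carrier A. y \<ominus>\<^bsub>A\<^esub> x \<in> I}" if x: "x \<in> carrier A" for x
  proof -
    have "y \<in> ?c x \<longleftrightarrow> y \<in> carrier A \<and> y \<ominus>\<^bsub>A\<^esub> x \<in> I" for y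
    proof
      assume "y \<in> ?c x"
      then obtain i where i: "i \<in> I" "y = i \<oplus>\<^bsub>A\<^esub> x" by (auto simp: a_r_coset_def')
      then have "i \<in> carrier A" using ID(1) by blast
      then have "y \<ominus>\<^bsub>A\<^esub> x = i" using x i by (simp add: A.minus_eq A.a_assoc A.r_neg)
      then show "y \<in> carrier A \<and> y \<ominus>\<^bsub>A\<^esub> x \<in> I" using i x \<open>i \<in> carrier A\<close> by simp
    next
      assume "y \<in> carrier A \<and> y \<ominus>\<^bsub>A\<^esub> x \<in> I"
      then show "y \<in> ?c x"
        using A.minus_add_cancel[of y x] x by (auto simp: a_r_coset_def' intro!: bexI[of _ "y \<ominus>\<^bsub>A\<^esub> x"])
    qed
    then show ?thesis by blast
  qed
  have self: "x \<in> ?c x" if "x \<in> carrier A" for x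
    using that A.minus_eq_zero_iff[of x x] ID(2) by (simp add: cos)
  have swap: "y \<ominus>\<^bsub>A\<^esub> x \<in> I" if "x \<ominus>\<^bsub>A\<^esub> y \<in> I" "x \<in> carrier A" "y \<in> carrier A" for x y
  proof -
    have "y \<ominus>\<^bsub>A\<^esub> x = (-1) \<odot>\<^bsub>A\<^esub> (x \<ominus>\<^bsub>A\<^esub> y)" using that by (simp add: A.expand A.a_ac)
    then show ?thesis using that ID(4) by simp
  qed
  have eq: "?c x = ?c y \<longleftrightarrow> x \<ominus>\<^bsub>A\<^esub> y \<in> I" if c: "x \<in> carrier A" "y \<in> carrier A" for x y
  proof
    assume "?c x = ?c y" then show "x \<ominus>\<^bsub>A\<^esub> y \<in> I" using self[OF c(1)] cos[OF c(2)] by auto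
  next
    assume xy: "x \<ominus>\<^bsub>A\<^esub> y \<in> I"
    have "z \<ominus>\<^bsub>A\<^esub> x \<in> I \<longleftrightarrow> z \<ominus>\<^bsub>A\<^esub> y \<in> I" if z: "z \<in> carrier A" for z
    proof
      assume "z \<ominus>\<^bsub>A\<^esub> x \<in> I"
      from ID(3)[OF this xy] show "z \<ominus>\<^bsub>A\<^esub> y \<in> I" unfolding A.minus_add_minus[OF z c] .
    next
      assume "z \<ominus>\<^bsub>A\<^esub> y \<in> I"
      from ID(3)[OF this swap[OF xy c]] show "z \<ominus>\<^bsub>A\<^esub> x \<in> I"
        unfolding A.minus_add_minus[OF z c(2,1)] .
    qed
    then show "?c x = ?c y" unfolding cos[OF c(1)] cos[OF c(2)] by (intro Collect_cong conj_cong refl)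
  qed
  have crc: "x \<in> carrier A \<Longrightarrow> y \<in> ?c x \<Longrightarrow> y \<in> carrier A" for x y by (simp add: cos)
  have UN: "(\<Union>y\<in>?c x. ?c (g y)) = ?c (g x)"
    if x: "x \<in> carrier A" and g: "\<And>y. y \<in> carrier A \<Longrightarrow> g y \<in> carrier A"
      and gI: "\<And>y. \<lbrakk>y \<in> carrier A; y \<ominus>\<^bsub>A\<^esub> x \<in> I\<rbrakk> \<Longrightarrow> g y \<ominus>\<^bsub>A\<^esub> g x \<in> I" for g x
  proof -
    have "?c (g y) = ?c (g x)" if "y \<in> ?c x" for y
      using that x cos[OF x] g gI by (auto simp: eq)
    then show ?thesis using self[OF x] by blast
  qed
  have Qsmult: "c \<odot>\<^bsub>quotient A I\<^esub> ?c x = ?c (c \<odot>\<^bsub>A\<^esub> x)" if x: "x \<in> carrier A" for c x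
  proof -
    have "c \<odot>\<^bsub>A\<^esub> y \<ominus>\<^bsub>A\<^esub> c \<odot>\<^bsub>A\<^esub> x \<in> I" if "y \<in> carrier A" "y \<ominus>\<^bsub>A\<^esub> x \<in> I" for y
    proof -
      have "c \<odot>\<^bsub>A\<^esub> y \<ominus>\<^bsub>A\<^esub> c \<odot>\<^bsub>A\<^esub> x = c \<odot>\<^bsub>A\<^esub> (y \<ominus>\<^bsub>A\<^esub> x)" using that x by (simp add: A.expand)
      then show ?thesis using that ID(4) by simp
    qed
    then show ?thesis using x by (simp add: quotient_def UN[OF x, of "\<lambda>y. c \<odot>\<^bsub>A\<^esub> y"])
  qed
  have Qstar: "star (quotient A I) (?c x) = ?c (star A x)" if x: "x \<in> carrier A" for x
  proof -
    have "star A y \<ominus>\<^bsub>A\<^esub> star A x \<in> I" if "y \<in> carrier A" "y \<ominus>\<^bsub>A\<^esub> x \<in> I" for y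
    proof -
      have "star A y \<ominus>\<^bsub>A\<^esub> star A x = star A (y \<ominus>\<^bsub>A\<^esub> x)" using that x by (simp add: A.expand)
      then show ?thesis using that cstar_ideal_star[OF A I] by simp
    qed
    then show ?thesis using x by (simp add: quotient_def UN[OF x, of "star A"])
  qed
  have Qmult: "?c x \<otimes>\<^bsub>quotient A I\<^esub> ?c y = ?c (x \<otimes>\<^bsub>A\<^esub> y)" if x: "x \<in> carrier A" and y: "y \<in> carrier A" for x y
  proof -
    have in1: "a \<otimes>\<^bsub>A\<^esub> z \<ominus>\<^bsub>A\<^esub> a \<otimes>\<^bsub>A\<^esub> y \<in> I" if "a \<in> carrier A" "z \<in> carrier A" "z \<ominus>\<^bsub>A\<^esub> y \<in> I" for a z
    proof -
      have "a \<otimes>\<^bsub>A\<^esub> z \<ominus>\<^bsub>A\<^esub> a \<otimes>\<^bsub>A\<^esub> y = a \<otimes>\<^bsub>A\<^esub> (z \<ominus>\<^bsub>A\<^esub> y)" using that y by (simp add: A.expand)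
      then show ?thesis using that ID(5) by simp
    qed
    have in2: "z \<otimes>\<^bsub>A\<^esub> y \<ominus>\<^bsub>A\<^esub> x \<otimes>\<^bsub>A\<^esub> y \<in> I" if "z \<in> carrier A" "z \<ominus>\<^bsub>A\<^esub> x \<in> I" for z
    proof -
      have "z \<otimes>\<^bsub>A\<^esub> y \<ominus>\<^bsub>A\<^esub> x \<otimes>\<^bsub>A\<^esub> y = (z \<ominus>\<^bsub>A\<^esub> x) \<otimes>\<^bsub>A\<^esub> y" using that x y by (simp add: A.expand)
      then show ?thesis using that y ID(6) by simp
    qed
    have "(\<Union>b\<in>?c y. ?c (a \<otimes>\<^bsub>A\<^esub> b)) = ?c (a \<otimes>\<^bsub>A\<^esub> y)" if "a \<in> carrier A" for a
      using that y in1 by (intro UN[OF y, of "\<lambda>b. a \<otimes>\<^bsub>A\<^esub> b"]) auto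
    moreover have "(\<Union>a\<in>?c x. ?c (a \<otimes>\<^bsub>A\<^esub> y)) = ?c (x \<otimes>\<^bsub>A\<^esub> y)"
      using x y in2 by (intro UN[OF x, of "\<lambda>a. a \<otimes>\<^bsub>A\<^esub> y"]) auto
    ultimately show ?thesis using crc[OF x] by (simp add: quotient_def rcoset_mult_def)
  qed
  have sg: "abelian_subgroup I A"
    using I by (intro abelian_subgroupI3)
      (auto simp: cstar_ideals_def additive_subgroup_def submodule_def A.abelian_group_axioms)
  have Qadd: "?c x \<oplus>\<^bsub>quotient A I\<^esub> ?c y = ?c (x \<oplus>\<^bsub>A\<^esub> y)" if "x \<in> carrier A" "y \<in> carrier A" for x y
    using abelian_subgroup.a_rcos_sum[OF sg that] by (simp add: quotient_def)
  have Qc: "carrier (quotient A I) = ?c ` carrier A"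
    by (auto simp: quotient_def A_RCOSETS_def')
  note Q = Qsmult Qstar Qmult Qadd
  show ?thesis
  proof
    assume "star_isomorphic B (quotient A I)"
    then obtain g where g: "star_isomorphism B (quotient A I) g" by (auto simp: star_isomorphic_def)
    then have bij: "bij_betw g (carrier B) (carrier (quotient A I))" by (simp add: star_isomorphism_def)
    define f where "f x = inv_into (carrier B) g (?c x)" for x
    have fB: "f x \<in> carrier B" and gf: "g (f x) = ?c x" if "x \<in> carrier A" for x
      using that bij bij_betwE[OF bij_betw_inv_into[OF bij]] bij_betw_inv_into_right[OF bij, of "?c x"]
      by (auto simp: f_def Qc)
    have inj: "a = b" if "g a = g b" "a \<in> carrier B" "b \<in> carrier B" for a b
      using that bij by (auto simp: bij_betw_def inj_on_def)
    have gs: "g (c \<odot>\<^bsub>B\<^esub> b) = c \<odot>\<^bsub>quotient A I\<^esub> g b" "g (star B b) = star (quotient A I) (g b)"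
      if "b \<in> carrier B" for b c using that g by (auto simp: star_isomorphism_def)
    have gb: "g (a \<oplus>\<^bsub>B\<^esub> b) = g a \<oplus>\<^bsub>quotient A I\<^esub> g b" "g (a \<otimes>\<^bsub>B\<^esub> b) = g a \<otimes>\<^bsub>quotient A I\<^esub> g b"
      if "a \<in> carrier B" "b \<in> carrier B" for a b using that g by (auto simp: star_isomorphism_def)
    have hom: "star_hom A B f"
      unfolding star_hom_def
      by (intro conjI ballI allI image_subsetI fB; (intro inj)?) (simp_all add: fB gf gs gb Q)
    moreover have "f ` carrier A = carrier B"
    proof (intro equalityI subsetI)
      fix b assume b: "b \<in> carrier B"
      then have "g b \<in> ?c ` carrier A" using bij_betwE[OF bij] Qc by blast
      then obtain x where x: "x \<in> carrier A" "g b = ?c x" by blast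
      then have "f x = b" using inj fB gf b by metis
      then show "b \<in> f ` carrier A" using x by blast
    qed (use fB in auto)
    moreover have "{x \<in> carrier A. f x = \<zero>\<^bsub>B\<^esub>} = I"
    proof -
      have f0: "f \<zero>\<^bsub>A\<^esub> = \<zero>\<^bsub>B\<^esub>"
        using cstar_hom.hom_zero[of A B f] hom A B by (simp add: cstar_hom_def cstar_hom_axioms_def)
      have "f x = \<zero>\<^bsub>B\<^esub> \<longleftrightarrow> x \<in> I" if x: "x \<in> carrier A" for x
      proof -
        have "f x = \<zero>\<^bsub>B\<^esub> \<longleftrightarrow> ?c x = ?c \<zero>\<^bsub>A\<^esub>"
          using gf[OF x] gf[of "\<zero>\<^bsub>A\<^esub>"] f0 inj fB x by (metis A.zero_closed)
        also have "\<dots> \<longleftrightarrow> x \<ominus>\<^bsub>A\<^esub> \<zero>\<^bsub>A\<^esub> \<in> I" by (rule eq[OF x A.zero_closed])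
        also have "x \<ominus>\<^bsub>A\<^esub> \<zero>\<^bsub>A\<^esub> = x" using x by (simp add: A.minus_eq_smult)
        finally show ?thesis .
      qed
      then show ?thesis using ID(1) by blast
    qed
    ultimately show "\<exists>f. star_hom A B f \<and> f ` carrier A = carrier B \<and> {x \<in> carrier A. f x = \<zero>\<^bsub>B\<^esub>} = I"
      by blast
  next
    assume "\<exists>f. star_hom A B f \<and> f ` carrier A = carrier B \<and> {x \<in> carrier A. f x = \<zero>\<^bsub>B\<^esub>} = I"
    then obtain f where f: "star_hom A B f" "f ` carrier A = carrier B" "{x \<in> carrier A. f x = \<zero>\<^bsub>B\<^esub>} = I"
      by blast
    interpret cstar_hom A B f using A B f by (simp add: cstar_hom_def cstar_hom_axioms_def)
    define g where "g b = {x \<in> carrier A. f x = b}" for b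
    have gf: "g (f x) = ?c x" if x: "x \<in> carrier A" for x
    proof -
      have fyx: "f y = f x \<longleftrightarrow> y \<ominus>\<^bsub>A\<^esub> x \<in> I" if y: "y \<in> carrier A" for y
      proof -
        have "f y = f x \<longleftrightarrow> f (y \<ominus>\<^bsub>A\<^esub> x) = \<zero>\<^bsub>B\<^esub>"
          using x y B.minus_eq_zero_iff[OF hom_simps(1)[OF y] hom_simps(1)[OF x]] by (simp add: hom_minus)
        then show ?thesis using f(3) x y by blast
      qed
      show ?thesis unfolding g_def cos[OF x] by (intro Collect_cong conj_cong refl fyx)
    qed
    have "star_isomorphism B (quotient A I) g"
      unfolding star_isomorphism_def
    proof (intro conjI)
      show "bij_betw g (carrier B) (carrier (quotient A I))"
        unfolding bij_betw_def
      proof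
        show "inj_on g (carrier B)"
          unfolding f(2)[symmetric] by (auto simp: inj_on_def g_def)
        show "g ` carrier B = carrier (quotient A I)"
          unfolding f(2)[symmetric] Qc image_image using gf by (simp cong: image_cong)
      qed
    qed (unfold f(2)[symmetric], auto simp: gf Q hom_simps(2-5)[symmetric])
    then show "star_isomorphic B (quotient A I)" by (auto simp: star_isomorphic_def)
  qed
qed

lemma star_hom_comp: "\<lbrakk>star_hom A B f; star_hom B C g\<rbrakk> \<Longrightarrow> star_hom A C (\<lambda>x. g (f x))"
  unfolding star_hom_def by (auto simp: image_subset_iff)

lemma star_hom_subalg: "\<lbrakk>star_hom A B f; I \<subseteq> J; J \<subseteq> carrier A; f ` I \<subseteq> K\<rbrakk> \<Longrightarrow> star_hom (subalg A I) (subalg B K) f"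
  unfolding star_hom_def by (auto simp: subset_iff)

lemma star_isomorphism_imp_hom: "star_isomorphism A B f \<Longrightarrow> star_hom A B f"
  unfolding star_hom_def star_isomorphism_def by (auto dest: bij_betwE)

lemma star_isomorphism_imp_hom_inv:
  assumes A: "cstar_algebra A" and f: "star_isomorphism A B f"
  shows "star_hom B A (inv_into (carrier A) f)"
proof -
  interpret cstar_algebra A by fact
  let ?g = "inv_into (carrier A) f"
  have bij: "bij_betw f (carrier A) (carrier B)" using f by (simp add: star_isomorphism_def)
  have gA: "?g b \<in> carrier A" and fg: "f (?g b) = b" if "b \<in> carrier B" for b
    using that bij_betwE[OF bij_betw_inv_into[OF bij]] bij_betw_inv_into_right[OF bij] by auto
  have gf: "?g (f x) = x" if "x \<in> carrier A" for x using that bij_betw_inv_into_left[OF bij] by auto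
  have hom: "f (x \<oplus>\<^bsub>A\<^esub> y) = f x \<oplus>\<^bsub>B\<^esub> f y" "f (x \<otimes>\<^bsub>A\<^esub> y) = f x \<otimes>\<^bsub>B\<^esub> f y"
    "f (c \<odot>\<^bsub>A\<^esub> x) = c \<odot>\<^bsub>B\<^esub> f x" "f (star A x) = star B (f x)"
    if "x \<in> carrier A" "y \<in> carrier A" for x y c
    using that f by (auto simp: star_isomorphism_def)
  show ?thesis
    unfolding star_hom_def
  proof (intro conjI ballI allI)
    show "?g ` carrier B \<subseteq> carrier A" using gA by blast
    fix a c assume a: "a \<in> carrier B"
    show "?g (c \<odot>\<^bsub>B\<^esub> a) = c \<odot>\<^bsub>A\<^esub> ?g a"
      using gf[of "c \<odot>\<^bsub>A\<^esub> ?g a"] hom(3)[OF gA[OF a] gA[OF a]] gA[OF a] fg[OF a] by simp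
    show "?g (star B a) = star A (?g a)"
      using gf[of "star A (?g a)"] hom(4)[OF gA[OF a] gA[OF a]] gA[OF a] fg[OF a] by simp
    fix b assume b: "b \<in> carrier B"
    show "?g (a \<oplus>\<^bsub>B\<^esub> b) = ?g a \<oplus>\<^bsub>A\<^esub> ?g b"
      using gf[of "?g a \<oplus>\<^bsub>A\<^esub> ?g b"] hom(1)[OF gA[OF a] gA[OF b]] gA a b fg by simp
    show "?g (a \<otimes>\<^bsub>B\<^esub> b) = ?g a \<otimes>\<^bsub>A\<^esub> ?g b"
      using gf[of "?g a \<otimes>\<^bsub>A\<^esub> ?g b"] hom(2)[OF gA[OF a] gA[OF b]] gA a b fg by simp
  qed
qed

lemma quotient_in_iff_hom:
  assumes A: "cstar_algebra A" and J: "J \<in> cstar_ideals A" and I: "I \<in> cstar_ideals A" "I \<subseteq> J"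
    and P: "\<forall>B\<in>P. cstar_algebra B"
  shows "quotient_in P A J I \<longleftrightarrow>
    (\<exists>B\<in>P. \<exists>f. star_hom (subalg A J) B f \<and> f ` J = carrier B \<and> {x \<in> J. f x = \<zero>\<^bsub>B\<^esub>} = I)"
proof -
  have "I \<in> cstar_ideals (subalg A J)" using cstar_ideals_subalg_iff[OF A J] I by blast
  note iff = quotient_iso_iff_hom[OF cstar_algebra_subalg[OF A J] this]
  show ?thesis
    unfolding quotient_in_def using P by (intro bex_cong refl) (simp add: iff)
qed

lemma vimage_in_cstar_ideals_subalg:
  assumes A: "cstar_algebra A" and J: "J \<in> cstar_ideals A" and B: "cstar_algebra B"
    and f: "star_hom (subalg A J) B f" and N: "N \<in> cstar_ideals B"
  shows "{x \<in> J. f x \<in> N} \<in> cstar_ideals A"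
proof -
  have "{x \<in> J. f x \<in> N} \<in> cstar_ideals (subalg A J)"
    using vimage_in_cstar_ideals[OF cstar_algebra_subalg[OF A J] B f N] by simp
  then show ?thesis by (rule cstar_ideal_of_ideal[OF A J])
qed

text \<open>This is the isomorphism \<open>f\<^sup>-\<^sup>1(K) / f\<^sup>-\<^sup>1(N) \<cong> K / N\<close> for a surjective \<open>f\<close>.\<close>

lemma quotient_in_vimage:
  assumes A: "cstar_algebra A" and J: "J \<in> cstar_ideals A" and B: "cstar_algebra B"
    and f: "star_hom (subalg A J) B f" and surj: "f ` J = carrier B"
    and K: "K \<in> cstar_ideals B" and N: "N \<in> cstar_ideals B" "N \<subseteq> K"
    and P: "\<forall>C\<in>P. cstar_algebra C"
    and q: "quotient_in P B K N"
  shows "quotient_in P A {x \<in> J. f x \<in> K} {x \<in> J. f x \<in> N}"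
proof -
  note v = vimage_in_cstar_ideals_subalg[OF A J B f]
  let ?K = "{x \<in> J. f x \<in> K}"
  obtain C g where C: "C \<in> P" and g: "star_hom (subalg B K) C g" "g ` K = carrier C"
    "{y \<in> K. g y = \<zero>\<^bsub>C\<^esub>} = N"
    using q unfolding quotient_in_iff_hom[OF B K N P] by blast
  have fK: "f ` ?K = K"
  proof (intro equalityI subsetI)
    fix y assume y: "y \<in> K"
    then have "y \<in> f ` J" using surj cstar_idealD(1)[OF B K] by blast
    then show "y \<in> f ` ?K" using y by blast
  qed auto
  have f': "star_hom (subalg A ?K) (subalg B K) f"
    using star_hom_subalg[OF f, of ?K J K] by auto
  have "star_hom (subalg A ?K) C (\<lambda>x. g (f x))"
    by (rule star_hom_comp[OF f' g(1)])
  moreover have "(\<lambda>x. g (f x)) ` ?K = carrier C"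
    using fK g(2) by (simp flip: image_image)
  moreover have "{x \<in> ?K. g (f x) = \<zero>\<^bsub>C\<^esub>} = {x \<in> J. f x \<in> N}"
    using g(3) by blast
  moreover have NK: "{x \<in> J. f x \<in> N} \<subseteq> ?K" using N(2) by blast
  ultimately show ?thesis
    unfolding quotient_in_iff_hom[OF A v[OF K] v[OF N(1)] NK P] using C by blast
qed

section \<open>The closure operator\<close>

lemma P_loD:
  assumes "P \<in> P_lo"
  shows "\<forall>A\<in>P. cstar_algebra A"
    "\<And>A. \<lbrakk>cstar_algebra A; carrier A = {\<zero>\<^bsub>A\<^esub>}\<rbrakk> \<Longrightarrow> A \<in> P"
    "\<And>A B. \<lbrakk>A \<in> P; cstar_algebra B; star_isomorphic A B\<rbrakk> \<Longrightarrow> B \<in> P"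
    "\<And>A I. \<lbrakk>A \<in> P; I \<in> cstar_ideals A\<rbrakk> \<Longrightarrow> subalg A I \<in> P"
proof -
  have a: "\<forall>A\<in>P. cstar_algebra A" "\<forall>A. cstar_algebra A \<and> carrier A = {\<zero>\<^bsub>A\<^esub>} \<longrightarrow> A \<in> P"
    "\<forall>A B. A \<in> P \<and> cstar_algebra B \<and> star_isomorphic A B \<longrightarrow> B \<in> P"
    "\<forall>A\<in>P. \<forall>I\<in>cstar_ideals A. subalg A I \<in> P"
    using assms unfolding P_lo_def cstar_property_def lower_stable_def mem_Collect_eq
    by - (elim conjE, assumption)+
  show "\<forall>A\<in>P. cstar_algebra A" by (rule a(1))
  show "A \<in> P" if "cstar_algebra A" "carrier A = {\<zero>\<^bsub>A\<^esub>}" for A using a(2) that by iprover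
  show "B \<in> P" if "A \<in> P" "cstar_algebra B" "star_isomorphic A B" for A B using a(3) that by iprover
  show "subalg A I \<in> P" if "A \<in> P" "I \<in> cstar_ideals A" for A I
    using bspec[OF bspec[OF a(4) that(1)] that(2)] .
qed

lemma dG_imp_cstar: "A \<in> dG P \<Longrightarrow> cstar_algebra A"
  by (simp add: dG_def)

text \<open>The zero algebra satisfies the condition on ideals, as its only ideal is zero.\<close>

lemma dG_iff:
  "A \<in> dG P \<longleftrightarrow> cstar_algebra A \<and>
     (\<forall>J\<in>cstar_ideals A. J \<noteq> {\<zero>\<^bsub>A\<^esub>} \<longrightarrow> (\<exists>I\<in>cstar_ideals A. I \<subset> J \<and> quotient_in P A J I))"
proof -
  have "\<forall>J\<in>cstar_ideals A. J = {\<zero>\<^bsub>A\<^esub>}" if "cstar_algebra A" "carrier A = {\<zero>\<^bsub>A\<^esub>}"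
  proof
    fix J assume "J \<in> cstar_ideals A"
    from cstar_idealD(1,2)[OF that(1) this] that(2) show "J = {\<zero>\<^bsub>A\<^esub>}" by auto
  qed
  then show ?thesis by (cases "carrier A = {\<zero>\<^bsub>A\<^esub>}") (auto simp: dG_def)
qed

lemma quotient_in_mono: "P \<subseteq> P1 \<Longrightarrow> quotient_in P A J I \<Longrightarrow> quotient_in P1 A J I"
  by (auto simp: quotient_in_def)

lemma dG_mono: "P \<subseteq> P1 \<Longrightarrow> dG P \<subseteq> dG P1"
proof
  fix A assume "P \<subseteq> P1" "A \<in> dG P"
  then show "A \<in> dG P1"
    unfolding dG_iff by (auto intro: quotient_in_mono[of P P1] dest!: bspec)
qed

lemma quotient_in_zero:
  assumes P: "\<forall>B\<in>P. cstar_algebra B" and A: "cstar_algebra A" and J: "J \<in> cstar_ideals A"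
    and JP: "subalg A J \<in> P"
  shows "quotient_in P A J {\<zero>\<^bsub>A\<^esub>}"
proof -
  have z: "{\<zero>\<^bsub>A\<^esub>} \<subseteq> J" using cstar_idealD(2)[OF A J] by simp
  then have "star_hom (subalg A J) (subalg A J) (\<lambda>x. x) \<and> (\<lambda>x. x) ` J = carrier (subalg A J)
      \<and> {x \<in> J. x = \<zero>\<^bsub>subalg A J\<^esub>} = {\<zero>\<^bsub>A\<^esub>}"
    by (auto simp: star_hom_def)
  then show ?thesis
    unfolding quotient_in_iff_hom[OF A J zero_in_cstar_ideals[OF A] z P] using JP by blast
qed

lemma subset_dG:
  assumes "P \<in> P_lo"
  shows "P \<subseteq> dG P"
proof
  fix A assume A: "A \<in> P"
  note PD = P_loD[OF assms]
  have cA: "cstar_algebra A" using PD(1) A by blast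
  show "A \<in> dG P"
    unfolding dG_iff
  proof (intro conjI ballI impI cA)
    fix J assume J: "J \<in> cstar_ideals A" "J \<noteq> {\<zero>\<^bsub>A\<^esub>}"
    have "quotient_in P A J {\<zero>\<^bsub>A\<^esub>}" by (rule quotient_in_zero[OF PD(1) cA J(1) PD(4)[OF A J(1)]])
    moreover have "{\<zero>\<^bsub>A\<^esub>} \<subset> J" using J cstar_idealD(2)[OF cA J(1)] by blast
    ultimately show "\<exists>I\<in>cstar_ideals A. I \<subset> J \<and> quotient_in P A J I"
      using zero_in_cstar_ideals[OF cA] by blast
  qed
qed

text \<open>Both the isomorphism and its inverse are contractive, so they exchange the closed ideals of the two
  algebras, although the definition of an isomorphism does not mention norms.\<close>

lemma dG_isomorphic:
  assumes P: "\<forall>C\<in>P. cstar_algebra C"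
    and A: "A \<in> dG P" and B: "cstar_algebra B" and iso: "star_isomorphic A B"
  shows "B \<in> dG P"
  unfolding dG_iff
proof (intro conjI ballI impI B)
  fix J assume J: "J \<in> cstar_ideals B" "J \<noteq> {\<zero>\<^bsub>B\<^esub>}"
  have cA: "cstar_algebra A" by (rule dG_imp_cstar[OF A])
  obtain f where f: "star_isomorphism A B f" using iso by (auto simp: star_isomorphic_def)
  let ?g = "inv_into (carrier A) f"
  have bij: "bij_betw f (carrier A) (carrier B)" using f by (simp add: star_isomorphism_def)
  have gA: "?g b \<in> carrier A" and fg: "f (?g b) = b" if "b \<in> carrier B" for b
    using that bij_betwE[OF bij_betw_inv_into[OF bij]] bij_betw_inv_into_right[OF bij] by auto
  have gf: "?g (f x) = x" if "x \<in> carrier A" for x using that bij_betw_inv_into_left[OF bij] by auto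
  have hg: "star_hom (subalg B (carrier B)) A ?g" using star_isomorphism_imp_hom_inv[OF cA f] by simp
  have hf: "star_hom A B f" by (rule star_isomorphism_imp_hom[OF f])
  interpret g: cstar_hom B A ?g using B cA hg by (simp add: cstar_hom_def cstar_hom_axioms_def)
  have JB: "J \<subseteq> carrier B" "\<zero>\<^bsub>B\<^esub> \<in> J" using cstar_idealD(1,2)[OF B J(1)] by auto
  define K where "K = {x \<in> carrier A. f x \<in> J}"
  have K: "K \<in> cstar_ideals A" unfolding K_def by (rule vimage_in_cstar_ideals[OF cA B hf J(1)])
  obtain y where y: "y \<in> J" "y \<noteq> \<zero>\<^bsub>B\<^esub>" using J JB by blast
  have "?g y \<in> K" using y JB gA fg by (auto simp: K_def)
  moreover have "?g y \<noteq> \<zero>\<^bsub>A\<^esub>"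
    using y JB fg g.hom_zero by (metis subsetD)
  ultimately have "K \<noteq> {\<zero>\<^bsub>A\<^esub>}" by blast
  then obtain N where N: "N \<in> cstar_ideals A" "N \<subset> K" "quotient_in P A K N"
    using A K unfolding dG_iff by blast
  have KJ: "{b \<in> carrier B. ?g b \<in> K} = J" using gA fg JB by (auto simp: K_def)
  let ?I = "{b \<in> carrier B. ?g b \<in> N}"
  have "?I \<in> cstar_ideals B" by (rule vimage_in_cstar_ideals[OF B cA g.hom N(1)])
  moreover have "quotient_in P B J ?I"
    using quotient_in_vimage[OF B carrier_in_cstar_ideals[OF B] cA hg _ K N(1) _ P N(3)]
      bij_betw_imp_surj_on[OF bij_betw_inv_into[OF bij]] N(2) KJ by auto
  moreover have "?I \<subset> J"
  proof -
    obtain x where x: "x \<in> K" "x \<notin> N" using N(2) by blast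
    then have "f x \<in> J" "f x \<notin> ?I" using gf by (auto simp: K_def)
    moreover have "?I \<subseteq> J" using N(2) KJ by blast
    ultimately show ?thesis by blast
  qed
  ultimately show "\<exists>I\<in>cstar_ideals B. I \<subset> J \<and> quotient_in P B J I" by blast
qed

text \<open>The closed ideals of \<open>I\<close> are closed ideals of \<open>A\<close>, and the quotients to be found are the same.\<close>

lemma dG_subalg:
  assumes A: "A \<in> dG P" and I: "I \<in> cstar_ideals A"
  shows "subalg A I \<in> dG P"
proof -
  have cA: "cstar_algebra A" by (rule dG_imp_cstar[OF A])
  show ?thesis
    unfolding dG_iff[of "subalg A I"]
  proof (intro conjI ballI impI cstar_algebra_subalg[OF cA I])
    fix J assume J: "J \<in> cstar_ideals (subalg A I)" "J \<noteq> {\<zero>\<^bsub>subalg A I\<^esub>}"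
    then have JA: "J \<in> cstar_ideals A" "J \<subseteq> I" and J0: "J \<noteq> {\<zero>\<^bsub>A\<^esub>}"
      using cstar_ideals_subalg_iff[OF cA I, of J] by simp_all
    obtain K where K: "K \<in> cstar_ideals A" "K \<subset> J" "quotient_in P A J K"
      using A JA(1) J0 unfolding dG_iff[of A] by blast
    show "\<exists>K\<in>cstar_ideals (subalg A I). K \<subset> J \<and> quotient_in P (subalg A I) J K"
    proof (intro bexI conjI)
      show "quotient_in P (subalg A I) J K" using K(3) by (simp add: quotient_in_def)
      show "K \<in> cstar_ideals (subalg A I)"
        unfolding cstar_ideals_subalg_iff[OF cA I] using K JA(2) by blast
    qed (rule K(2))
  qed
qed

lemma dG_in_P_lo:
  assumes "P \<in> P_lo"
  shows "dG P \<in> P_lo"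
proof -
  note PD = P_loD[OF assms]
  have "cstar_property (dG P)"
    unfolding cstar_property_def
  proof (intro conjI ballI allI impI)
    show "A \<in> dG P" if "cstar_algebra A \<and> carrier A = {\<zero>\<^bsub>A\<^esub>}" for A
      using subset_dG[OF assms] PD(2)[of A] that by (elim conjE) (rule subsetD)
    show "B \<in> dG P" if "A \<in> dG P \<and> cstar_algebra B \<and> star_isomorphic A B" for A B
      using that by (elim conjE) (rule dG_isomorphic[OF PD(1)])
  qed (rule dG_imp_cstar)
  then show ?thesis by (simp add: P_lo_def lower_stable_def dG_subalg)
qed

text \<open>A nonzero ideal \<open>J\<close> of an algebra in \<open>dG (dG P)\<close> has a nonzero quotient \<open>B\<close> in \<open>dG P\<close>, and \<open>B\<close>, as an ideal of
  itself, has a nonzero quotient in \<open>P\<close>. The composition shows that \<open>J\<close> has a nonzero quotient in \<open>P\<close>.\<close>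

lemma dG_idem:
  assumes P: "\<forall>C\<in>P. cstar_algebra C"
  shows "dG (dG P) \<subseteq> dG P"
proof
  fix A assume A: "A \<in> dG (dG P)"
  have cA: "cstar_algebra A" by (rule dG_imp_cstar[OF A])
  have cdG: "\<forall>C\<in>dG P. cstar_algebra C" by (intro ballI dG_imp_cstar)
  show "A \<in> dG P"
    unfolding dG_iff[of A P]
  proof (intro conjI ballI impI cA)
    fix J assume J: "J \<in> cstar_ideals A" "J \<noteq> {\<zero>\<^bsub>A\<^esub>}"
    then obtain I where I: "I \<in> cstar_ideals A" "I \<subset> J" "quotient_in (dG P) A J I"
      using A unfolding dG_iff[of A "dG P"] by blast
    obtain B f where B: "B \<in> dG P" and f: "star_hom (subalg A J) B f" "f ` J = carrier B"
      "{x \<in> J. f x = \<zero>\<^bsub>B\<^esub>} = I"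
      using I(3) unfolding quotient_in_iff_hom[OF cA J(1) I(1) psubset_imp_subset[OF I(2)] cdG]
      by (elim bexE exE conjE) (rule that)
    have cB: "cstar_algebra B" by (rule dG_imp_cstar[OF B])
    have cBi: "carrier B \<in> cstar_ideals B" by (rule carrier_in_cstar_ideals[OF cB])
    have ker: "x \<in> I \<longleftrightarrow> f x = \<zero>\<^bsub>B\<^esub>" if "x \<in> J" for x
      using that unfolding f(3)[symmetric] by simp
    obtain x where x: "x \<in> J" "x \<notin> I" using I(2) by (elim psubsetE) (blast)
    then have "f x \<in> carrier B" "f x \<noteq> \<zero>\<^bsub>B\<^esub>" using ker f(2)[symmetric] by simp_all
    then have "carrier B \<noteq> {\<zero>\<^bsub>B\<^esub>}" by auto
    from mp[OF bspec[OF conjunct2[OF B[unfolded dG_iff]] cBi] this]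
    obtain N where N: "N \<in> cstar_ideals B" "N \<subset> carrier B" "quotient_in P B (carrier B) N"
      by blast
    let ?N = "{x \<in> J. f x \<in> N}"
    have "{x \<in> J. f x \<in> carrier B} = J" using f(2) by blast
    then have "quotient_in P A J ?N"
      using quotient_in_vimage[OF cA J(1) cB f(1,2) cBi N(1) psubset_imp_subset[OF N(2)] P N(3)]
      by (simp only:)
    moreover have "?N \<subset> J"
    proof -
      obtain y where y: "y \<in> f ` J" "y \<notin> N" using N(2) unfolding f(2) by (elim psubsetE) blast
      then show ?thesis by auto
    qed
    ultimately show "\<exists>I\<in>cstar_ideals A. I \<subset> J \<and> quotient_in P A J I"
      using vimage_in_cstar_ideals_subalg[OF cA J(1) cB f(1) N(1)] by (intro bexI conjI)
  qed
qed

lemma dG_dG: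
  assumes "P \<in> P_lo" shows "dG (dG P) = dG P"
  using dG_idem[OF P_loD(1)[OF assms]] subset_dG[OF dG_in_P_lo[OF assms]] by blast

section \<open>Transfinite iteration\<close>

text \<open>A transfinite chain can be described without ordinals: iterate a decreasing function \<open>\<sigma>\<close> from a top
  element, taking intersections at limits. The iterates form the smallest set that contains the top and is
  closed under \<open>\<sigma>\<close> and intersections of chains. Compared with a chain indexed by a well-order, membership in such
  a tower can be proved by closure alone, which is what is needed to insert new chains between the members of
  a given one.\<close>

locale descending_tower =
  fixes U :: "'a set set" and \<sigma> :: "'a set \<Rightarrow> 'a set" and top_set :: "'a set"
  assumes Inter_closed: "\<lbrakk>S \<subseteq> U; S \<noteq> {}\<rbrakk> \<Longrightarrow> \<Inter>S \<in> U"
    and step_closed: "M \<in> U \<Longrightarrow> \<sigma> M \<in> U" and step_subset: "M \<in> U \<Longrightarrow> \<sigma> M \<subseteq> M"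
    and top_in: "top_set \<in> U"
begin

definition geq :: "'a set rel" where "geq = {(M, N). M \<in> U \<and> N \<in> U \<and> N \<subseteq> M}"

lemma Field_geq: "Field geq = U"
  by (auto simp: geq_def Field_def)

lemma Chains_geq: "C \<in> Chains geq \<Longrightarrow> C \<subseteq> U"
  by (auto simp: Chains_def geq_def)

sublocale bw: bourbaki_witt_fixpoint Inter geq \<sigma>
proof
  show "Partial_order geq"
    unfolding partial_order_on_def preorder_on_def Field_geq
    by (auto simp: geq_def refl_on_def trans_def antisym_def)
  show "(\<Inter>M, z) \<in> geq" if "M \<in> Chains geq" "M \<noteq> {}" "\<And>x. x \<in> M \<Longrightarrow> (x, z) \<in> geq" for M z
    using that Inter_closed[OF Chains_geq[OF that(1)]] by (auto simp: geq_def)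
  show "(x, \<Inter>M) \<in> geq" if "M \<in> Chains geq" "x \<in> M" for M x
    using that Inter_closed[OF Chains_geq[OF that(1)]] Chains_geq[OF that(1)] by (auto simp: geq_def)
  show "\<Inter>M \<in> Field geq" if "M \<in> Chains geq" "M \<noteq> {}" for M
    using that Inter_closed[OF Chains_geq[OF that(1)]] by (simp add: Field_geq)
  show "(x, \<sigma> x) \<in> geq" if "x \<in> Field geq" for x
  proof -
    have "x \<in> U" using that by (simp add: Field_geq)
    then show ?thesis using step_closed step_subset by (simp add: geq_def)
  qed
qed

abbreviation tower :: "'a set set" where "tower \<equiv> bw.iterates_above top_set"

lemma tower_U: "M \<in> tower \<Longrightarrow> M \<in> U"
  using bw.iterates_above_Field[of M top_set] top_in by (simp add: Field_geq)

lemma tower_subset_top: "M \<in> tower \<Longrightarrow> M \<subseteq> top_set"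
  using bw.iterates_above_ge[of M top_set] top_in by (simp add: Field_geq) (simp add: geq_def)

lemma tower_Inter: "\<lbrakk>S \<subseteq> tower; S \<noteq> {}\<rbrakk> \<Longrightarrow> \<Inter>S \<in> tower"
  using in_Chains_subset[OF bw.chain_iterates_above, of top_set S] top_in
  by (intro bw.iterates_above.Sup) (auto simp: Field_geq)

text \<open>No iterate lies strictly between \<open>\<sigma> M\<close> and \<open>M\<close>.\<close>

lemma tower_dichotomy:
  assumes "M \<in> tower" "N \<in> tower"
  shows "M \<subseteq> N \<or> N \<subseteq> \<sigma> M"
proof -
  have U: "M \<in> Field geq" "N \<in> Field geq" "\<sigma> M \<in> Field geq"
    using assms tower_U step_closed by (auto simp: Field_geq)
  consider "M \<in> bw.iterates_above N" | "N \<in> bw.iterates_above M"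
    using bw.iterates_above_triangle[OF assms] top_in Field_geq by auto
  then show ?thesis
  proof cases
    case 1
    from bw.iterates_above_ge[OF this U(2)] show ?thesis by (simp add: geq_def)
  next
    case 2
    from bw.iterates_above_successor[OF this U(1)]
    consider "N = M" | "N \<in> bw.iterates_above (\<sigma> M)" by blast
    then show ?thesis
    proof cases
      case 2
      from bw.iterates_above_ge[OF this U(3)] show ?thesis by (simp add: geq_def)
    qed simp
  qed
qed

lemma tower_linear: "\<lbrakk>M \<in> tower; N \<in> tower\<rbrakk> \<Longrightarrow> M \<subseteq> N \<or> N \<subseteq> M"
  using tower_dichotomy[of M N] step_subset[OF tower_U, of M] by auto

lemma tower_fixed_point_least:
  assumes M: "M \<in> tower" "\<sigma> M = M" and N: "N \<in> tower"
  shows "M \<subseteq> N"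
  using N
proof induction
  case base
  show ?case by (rule tower_subset_top[OF M(1)])
next
  case (step x)
  from tower_dichotomy[OF step.hyps M(1)] show ?case
  proof
    assume "x \<subseteq> M"
    with step.IH have "x = M" by simp
    then show ?case using M(2) by simp
  qed
next
  case (Sup C)
  then show ?case by (intro Inter_greatest)
qed

text \<open>Let \<open>M\<close> be the least upper bound of \<open>S\<close> in the tower. If \<open>M\<close> is not in \<open>S\<close>, then \<open>\<sigma> M\<close> is an upper bound as
  well, so \<open>M\<close> is a fixed point of \<open>\<sigma>\<close>; but a fixed point lies below the whole tower, so every element of \<open>S\<close>
  equals \<open>M\<close>, a contradiction.\<close>

lemma tower_has_greatest:
  assumes S: "S \<subseteq> tower" "S \<noteq> {}"
  shows "\<exists>M\<in>S. \<forall>N\<in>S. N \<subseteq> M"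
proof (rule ccontr)
  assume no: "\<not> ?thesis"
  define M where "M = \<Inter>{M \<in> tower. \<forall>N\<in>S. N \<subseteq> M}"
  have top: "top_set \<in> {M \<in> tower. \<forall>N\<in>S. N \<subseteq> M}"
    using S tower_subset_top bw.iterates_above.base by blast
  have M: "M \<in> tower" unfolding M_def using top by (intro tower_Inter) auto
  have up: "N \<subseteq> M" if "N \<in> S" for N using that by (auto simp: M_def)
  have notin: "M \<notin> S" using no up by blast
  have "N \<subseteq> \<sigma> M" if N: "N \<in> S" for N
  proof -
    have "\<not> M \<subseteq> N" using up[OF N] N notin by (metis subset_antisym)
    then show ?thesis using tower_dichotomy[OF M subsetD[OF S(1) N]] by simp
  qed
  then have "\<sigma> M \<in> {M \<in> tower. \<forall>N\<in>S. N \<subseteq> M}" using bw.iterates_above.step[OF M] by simp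
  then have "M \<subseteq> \<sigma> M" by (subst (1) M_def) (rule Inter_lower)
  with step_subset[OF tower_U[OF M]] have fp: "\<sigma> M = M" by (rule subset_antisym)
  obtain N where N: "N \<in> S" using S(2) by blast
  have "N = M" using up[OF N] tower_fixed_point_least[OF M fp subsetD[OF S(1) N]] by (rule subset_antisym)
  then show False using notin N by simp
qed


definition segment :: "'a set \<Rightarrow> 'a set set" where "segment I = {M \<in> tower. I \<subseteq> M}"

definition segment_geq :: "'a set \<Rightarrow> 'a set rel"
  where "segment_geq I = {(M, N). M \<in> segment I \<and> N \<in> segment I \<and> N \<subseteq> M}"

text \<open>Reverse inclusion makes the part of the tower above \<open>I\<close> a well-order in which successors are values of
  \<open>\<sigma>\<close> and limit elements are intersections. A limit element \<open>M\<close> equals the intersection \<open>K\<close> of its predecessors: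
  otherwise \<open>K\<close>, and then \<open>\<sigma> K\<close>, would be a predecessor of \<open>M\<close>, so \<open>K\<close> would be a fixed point of \<open>\<sigma>\<close> above \<open>M\<close>.\<close>

lemma segment_well_order:
  assumes I: "I \<in> tower"
  shows "Field (segment_geq I) = segment I" "Well_order (segment_geq I)"
    and "M \<in> underS (segment_geq I) I \<Longrightarrow> wo_rel.suc (segment_geq I) {M} = \<sigma> M"
    and "limit_elem (segment_geq I) M \<Longrightarrow> M = \<Inter>(underS (segment_geq I) M)"
proof -
  define C where "C = segment I"
  define r where "r = segment_geq I"
  note C_alt = C_def[unfolded segment_def]
  have r_iff: "(M, N) \<in> r \<longleftrightarrow> M \<in> C \<and> N \<in> C \<and> N \<subseteq> M" for M N by (simp add: r_def segment_geq_def C_def)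
  have CT: "C \<subseteq> tower" by (auto simp: C_alt)
  have F: "Field r = C" by (auto simp: Field_def r_iff)
  have "wf (r - Id)"
  proof (rule wfI_min)
    fix x Q assume x: "x \<in> (Q :: 'a set set)"
    show "\<exists>z\<in>Q. \<forall>y. (y, z) \<in> r - Id \<longrightarrow> y \<notin> Q"
    proof (cases "Q \<inter> C = {}")
      case True
      then show ?thesis using x by (auto simp: r_iff)
    next
      case False
      then obtain M where M: "M \<in> Q \<inter> C" and max: "\<forall>N\<in>Q \<inter> C. N \<subseteq> M"
        using tower_has_greatest[of "Q \<inter> C"] CT by (metis Int_lower2 subset_trans)
      have "y \<notin> Q" if "(y, M) \<in> r - Id" for y
      proof
        assume "y \<in> Q"
        with max that have "y \<subseteq> M" "M \<subseteq> y" "y \<noteq> M" by (auto simp: r_iff)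
        then show False by simp
      qed
      then show ?thesis using M by auto
    qed
  qed
  moreover have "Linear_order r"
    unfolding linear_order_on_def partial_order_on_def preorder_on_def F
  proof (intro conjI)
    show "total_on C r"
    proof (rule total_onI)
      fix M N assume "M \<in> C" "N \<in> C"
      then show "(M, N) \<in> r \<or> (N, M) \<in> r"
        using tower_linear[of M N] by (auto simp: r_iff C_alt)
    qed
  qed (auto simp: refl_on_def trans_def antisym_def r_iff)
  ultimately have wo: "Well_order r" by (simp add: well_order_on_def)
  have wr: "wo_rel r" using wo by (simp add: wo_rel_def)
  have suc: "wo_rel.suc r {M} = \<sigma> M" if M: "M \<in> underS r I" for M
  proof -
    have M': "M \<in> tower" "I \<subseteq> M" "M \<noteq> I" using M by (auto simp: underS_def r_iff C_alt)
    have "\<not> M \<subseteq> I" using M'(2,3) by (metis subset_antisym)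
    then have "I \<subseteq> \<sigma> M" using tower_dichotomy[OF M'(1) I] by simp
    then have sC: "\<sigma> M \<in> C" using bw.iterates_above.step[OF M'(1)] by (simp add: C_alt)
    have sM: "\<sigma> M \<noteq> M" using tower_fixed_point_least[OF M'(1) _ I] \<open>\<not> M \<subseteq> I\<close> by blast
    have MC: "M \<in> C" using M' by (simp add: C_alt)
    have "\<sigma> M = wo_rel.suc r {M}"
    proof (rule wo_rel.equals_suc_AboveS[OF wr])
      show "{M} \<subseteq> Field r" using MC F by simp
      show "\<sigma> M \<in> AboveS r {M}"
        using sC sM MC step_subset[OF tower_U[OF M'(1)]] by (simp add: AboveS_def F r_iff)
      show "(\<sigma> M, N) \<in> r" if "N \<in> AboveS r {M}" for N
      proof -
        have N: "N \<in> C" "N \<noteq> M" "N \<subseteq> M" using that by (auto simp: AboveS_def F r_iff)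
        then have "\<not> M \<subseteq> N" by (metis subset_antisym)
        then have "N \<subseteq> \<sigma> M" using tower_dichotomy[OF M'(1) subsetD[OF CT N(1)]] by simp
        then show ?thesis using N sC by (simp add: r_iff)
      qed
    qed
    then show ?thesis by simp
  qed
  have lim: "M = \<Inter>(underS r M)" if lim: "limit_elem r M"
  proof -
    define K where "K = \<Inter>(underS r M)"
    have MC: "M \<in> C" and ne: "underS r M \<noteq> {}" and nsuc: "\<And>N. N \<in> underS r M \<Longrightarrow> wo_rel.suc r {N} \<noteq> M"
      using lim by (auto simp: limit_elem_def F)
    have MT: "M \<in> tower" using MC CT by blast
    have KT: "K \<in> tower" unfolding K_def using ne CT by (intro tower_Inter) (auto simp: underS_def r_iff)
    have MK: "M \<subseteq> K" by (auto simp: K_def underS_def r_iff)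
    show ?thesis
    proof (rule ccontr)
      assume "M \<noteq> \<Inter>(underS r M)"
      then have neq: "K \<noteq> M" by (simp add: K_def)
      have IM: "I \<subseteq> M" using MC by (simp add: C_alt)
      have KC: "K \<in> C" using KT IM MK by (auto simp: C_alt)
      have KM: "\<not> K \<subseteq> M" using neq MK by (metis subset_antisym)
      have Ku: "K \<in> underS r M" using neq MK KC MC by (simp add: underS_def r_iff)
      have "K \<in> underS r I" using IM KM KC I by (auto simp: underS_def r_iff C_alt)
      with suc nsuc[OF Ku] have sK: "\<sigma> K \<noteq> M" by simp
      have M\<sigma>: "M \<subseteq> \<sigma> K" using tower_dichotomy[OF KT MT] KM by simp
      then have "\<sigma> K \<in> C" using IM bw.iterates_above.step[OF KT] by (auto simp: C_alt)
      then have "\<sigma> K \<in> underS r M" using sK M\<sigma> MC by (simp add: underS_def r_iff)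
      then have "K \<subseteq> \<sigma> K" unfolding K_def by (rule Inter_lower)
      with step_subset[OF tower_U[OF KT]] have fp: "\<sigma> K = K" by (rule subset_antisym)
      then show False using tower_fixed_point_least[OF KT fp MT] KM by simp
    qed
  qed
  show "Field (segment_geq I) = segment I" using F by (simp add: C_def r_def)
  show "Well_order (segment_geq I)" using wo by (simp add: r_def)
  show "M \<in> underS (segment_geq I) I \<Longrightarrow> wo_rel.suc (segment_geq I) {M} = \<sigma> M"
    using suc unfolding r_def .
  show "limit_elem (segment_geq I) M \<Longrightarrow> M = \<Inter>(underS (segment_geq I) M)"
    using lim unfolding r_def .
qed

end

lemma tower_imp_ll_dual:
  assumes tw: "descending_tower (cstar_ideals A) \<sigma> J"
    and step: "\<And>M. \<lbrakk>M \<in> cstar_ideals A; \<sigma> M \<noteq> M\<rbrakk> \<Longrightarrow> ll P A (\<sigma> M) M"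
    and I: "I \<in> bourbaki_witt_fixpoint.iterates_above Inter (descending_tower.geq (cstar_ideals A)) \<sigma> J"
  shows "ll_dual P A I J"
proof -
  interpret descending_tower "cstar_ideals A" \<sigma> J by (rule tw)
  define C where "C = segment I"
  define r where "r = segment_geq I"
  note C_alt = C_def[unfolded segment_def]
  note W = segment_well_order[OF I, folded C_def r_def]
  have IC: "I \<in> C" using I by (simp add: C_alt)
  have JC: "J \<in> C" using tower_subset_top[OF I] bw.iterates_above.base by (simp add: C_alt)
  have r_iff: "(M, N) \<in> r \<longleftrightarrow> M \<in> C \<and> N \<in> C \<and> N \<subseteq> M" for M N by (simp add: r_def segment_geq_def C_def)
  have CU: "M \<in> cstar_ideals A" if "M \<in> C" for M using that tower_U by (simp add: C_alt)
  have ends: "(J, M) \<in> r" "(M, I) \<in> r" if "M \<in> C" for M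
    using that IC JC tower_subset_top by (auto simp: r_iff C_alt)
  have st: "ll P A (wo_rel.suc r {M}) M" if M: "M \<in> underS r I" for M
  proof -
    have M': "M \<in> tower" "\<not> M \<subseteq> I" using M by (auto simp: underS_def r_iff C_alt)
    have "\<sigma> M \<noteq> M" using tower_fixed_point_least[OF M'(1) _ I] M'(2) by blast
    then show ?thesis unfolding W(3)[OF M] by (rule step[OF tower_U[OF M'(1)]])
  qed
  have lm: "M = (\<Inter>N\<in>underS r M. N)" if "limit_elem r M" for M using W(4)[OF that] by simp
  show ?thesis
    unfolding ll_dual_def
    by (rule exI[of _ r], rule exI[of _ J], rule exI[of _ I], rule exI[of _ "\<lambda>M. M"])
       (use W(1,2) IC JC CU ends st lm in \<open>simp\<close>)
qed

section \<open>Refinement of chains and the dual radical\<close>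

lemma ll_subset: "ll P A I J \<Longrightarrow> I \<subseteq> J"
  by (simp add: ll_def)

text \<open>A step \<open>K / L \<cong> B\<close> with \<open>B\<close> in \<open>dG P\<close> can be refined by steps from \<open>P\<close>: the preimages in \<open>K\<close> of the
  closed ideals of \<open>B\<close> form a family that is closed under intersections, and each of them except \<open>L\<close> can be
  decreased within the family by a step from \<open>P\<close>.\<close>

lemma ll_refinement:
  assumes A: "cstar_algebra A" and P: "\<forall>B\<in>P. cstar_algebra B"
    and ll: "ll (dG P) A L K"
  shows "\<exists>\<D>. \<D> \<subseteq> cstar_ideals A \<and> K \<in> \<D> \<and> (\<forall>M\<in>\<D>. L \<subseteq> M \<and> M \<subseteq> K) \<and>
    (\<forall>S. S \<subseteq> \<D> \<longrightarrow> S \<noteq> {} \<longrightarrow> \<Inter>S \<in> \<D>) \<and>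
    (\<forall>M\<in>\<D>. M \<noteq> L \<longrightarrow> (\<exists>M'\<in>\<D>. M' \<noteq> M \<and> ll P A M' M))"
proof -
  have L: "L \<in> cstar_ideals A" "K \<in> cstar_ideals A" "L \<subseteq> K" "quotient_in (dG P) A K L"
    using ll by (auto simp: ll_def)
  have cdG: "\<forall>C\<in>dG P. cstar_algebra C" by (intro ballI dG_imp_cstar)
  obtain B f where B: "B \<in> dG P" and f: "star_hom (subalg A K) B f" "f ` K = carrier B"
    "{x \<in> K. f x = \<zero>\<^bsub>B\<^esub>} = L"
    using L(4) unfolding quotient_in_iff_hom[OF A L(2,1,3) cdG]
    by (elim bexE exE conjE) (rule that)
  have cB: "cstar_algebra B" by (rule dG_imp_cstar[OF B])
  have cBi: "carrier B \<in> cstar_ideals B" by (rule carrier_in_cstar_ideals[OF cB])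
  define pre where "pre N = {x \<in> K. f x \<in> N}" for N
  have pre: "pre N \<in> cstar_ideals A" if "N \<in> cstar_ideals B" for N
    unfolding pre_def by (rule vimage_in_cstar_ideals_subalg[OF A L(2) cB f(1) that])
  have preB: "pre (carrier B) = K" using f(2) by (auto simp: pre_def)
  have pre0: "pre {\<zero>\<^bsub>B\<^esub>} = L" using f(3) by (simp add: pre_def)
  have mono: "pre N \<subseteq> pre N'" if "N \<subseteq> N'" for N N' using that by (auto simp: pre_def)
  have strict: "pre N \<noteq> pre N'" if NN': "N \<subset> N'" "N' \<subseteq> carrier B" for N N'
  proof -
    obtain y where y: "y \<in> N'" "y \<notin> N" using NN'(1) by (elim psubsetE) blast
    then have "y \<in> f ` K" using NN'(2) f(2) by auto
    then obtain x where "x \<in> K" "f x = y" by blast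
    with y have "x \<in> pre N'" "x \<notin> pre N" by (auto simp: pre_def)
    then show ?thesis by auto
  qed
  let ?D = "pre ` cstar_ideals B"
  have bounds: "L \<subseteq> M \<and> M \<subseteq> K" if "M \<in> ?D" for M
  proof -
    obtain N where N: "N \<in> cstar_ideals B" "M = pre N" using \<open>M \<in> ?D\<close> by blast
    have "L \<subseteq> pre N" unfolding pre0[symmetric] using cstar_idealD(2)[OF cB N(1)] by (intro mono) simp
    moreover have "pre N \<subseteq> K" by (auto simp: pre_def)
    ultimately show ?thesis using N(2) by simp
  qed
  have inter: "\<Inter>S \<in> ?D" if S: "S \<subseteq> ?D" "S \<noteq> {}" for S
  proof -
    obtain T where T: "T \<subseteq> cstar_ideals B" "S = pre ` T" using subset_imageE[OF S(1)] by metis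
    then have T0: "T \<noteq> {}" using S(2) by auto
    then have "\<Inter>S = pre (\<Inter>T)" unfolding T(2) by (auto simp: pre_def)
    then show ?thesis using Inter_in_cstar_ideals[OF cB T(1) T0] by simp
  qed
  have descend: "\<exists>M'\<in>?D. M' \<noteq> M \<and> ll P A M' M" if M: "M \<in> ?D" "M \<noteq> L" for M
  proof -
    obtain N where N: "N \<in> cstar_ideals B" "M = pre N" using M(1) by blast
    have "N \<noteq> {\<zero>\<^bsub>B\<^esub>}" using M(2) N(2) pre0 by auto
    from mp[OF bspec[OF conjunct2[OF B[unfolded dG_iff]] N(1)] this]
    obtain N' where N': "N' \<in> cstar_ideals B" "N' \<subset> N" "quotient_in P B N N'" by blast
    have "quotient_in P A (pre N) (pre N')"
      unfolding pre_def
      by (rule quotient_in_vimage[OF A L(2) cB f(1,2) N(1) N'(1) psubset_imp_subset[OF N'(2)] P N'(3)])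
    then have "ll P A (pre N') M"
      using pre[OF N(1)] pre[OF N'(1)] mono[OF psubset_imp_subset[OF N'(2)]] by (simp add: ll_def N(2))
    moreover have "pre N' \<noteq> M"
      unfolding N(2) by (rule strict[OF N'(2) cstar_idealD(1)[OF cB N(1)]])
    ultimately show ?thesis using N'(1) by (intro bexI[of _ "pre N'"] conjI) simp_all
  qed
  show ?thesis
  proof (rule exI[of _ ?D], intro conjI)
    show "?D \<subseteq> cstar_ideals A" using pre by auto
    show "K \<in> ?D" using preB cBi by (intro image_eqI[of _ _ "carrier B"]) simp_all
    show "\<forall>M\<in>?D. L \<subseteq> M \<and> M \<subseteq> K" by (intro ballI bounds)
    show "\<forall>S. S \<subseteq> ?D \<longrightarrow> S \<noteq> {} \<longrightarrow> \<Inter>S \<in> ?D" by (intro allI impI inter)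
    show "\<forall>M\<in>?D. M \<noteq> L \<longrightarrow> (\<exists>M'\<in>?D. M' \<noteq> M \<and> ll P A M' M)" by (intro ballI impI descend)
  qed
qed

lemma descending_chain_antimono:
  assumes wo: "Well_order r" and g: "\<forall>i\<in>Field r. (i, g) \<in> r"
    and step: "\<forall>i\<in>underS r g. F (wo_rel.suc r {i}) \<subseteq> F i"
    and lim: "\<forall>i. limit_elem r i \<longrightarrow> F i = (\<Inter>j\<in>underS r i. F j)"
  shows "(i, j) \<in> r \<Longrightarrow> F j \<subseteq> F i"
proof (induction j arbitrary: i rule: wo_rel.well_order_induct[OF wo_rel.intro[OF wo]])
  case (1 j)
  interpret wo_rel r by (rule wo_rel.intro[OF wo])
  have jF: "j \<in> Field r" "i \<in> Field r" using 1(2) by (auto intro: FieldI1 FieldI2)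
  show ?case
  proof (cases "i = j")
    case False
    then have iu: "i \<in> underS j" using 1(2) by (simp add: underS_def)
    show ?thesis
    proof (cases "limit_elem r j")
      case True
      then show ?thesis using lim iu by auto
    next
      case False
      then obtain k where k: "k \<in> underS j" "suc {k} = j"
        using iu jF by (auto simp: limit_elem_def)
      have kj: "(k, j) \<in> r" "k \<noteq> j" using k(1) by (auto simp: underS_def)
      have kF: "k \<in> Field r" using kj by (auto intro: FieldI1)
      have "(j, g) \<in> r" using g jF by blast
      then have "(k, g) \<in> r" "k \<noteq> g" using kj TRANS ANTISYM by (auto dest: transD antisymD)
      then have "k \<in> underS g" by (simp add: underS_def)
      then have Fjk: "F j \<subseteq> F k" using step k(2) by auto
      have "(i, k) \<in> r"
      proof (rule ccontr)
        assume n: "(i, k) \<notin> r"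
        then have "(k, i) \<in> r" "i \<noteq> k" using TOTALS jF kF REFL by (auto simp: refl_on_def)
        then have "i \<in> AboveS {k}" using jF by (simp add: AboveS_def)
        then have "(j, i) \<in> r" using suc_least_AboveS k(2) by blast
        then show False using 1(2) \<open>i \<noteq> j\<close> ANTISYM by (auto dest: antisymD)
      qed
      then have "F k \<subseteq> F i" using 1(1) kj by blast
      then show ?thesis using Fjk by simp
    qed
  qed simp
qed

text \<open>Each step of the given chain is refined by a family \<open>D i\<close> as above. The function \<open>\<sigma>\<close> decreases a
  member of \<open>D i\<close> within \<open>D i\<close> as long as the lower end of the step is not reached. Every member of the given chain
  belongs to the tower of \<open>\<sigma>\<close>: the smallest member of \<open>D i\<close> in the tower is fixed by \<open>\<sigma>\<close> and hence is the lower
  end of the step, and limits of the given chain are intersections.\<close>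

lemma ll_dual_dG_imp_ll_dual:
  assumes A: "cstar_algebra A" and P: "\<forall>B\<in>P. cstar_algebra B"
    and lld: "ll_dual (dG P) A I J"
  shows "ll_dual P A I J"
proof -
  obtain r :: "'a set rel" and b g F where wo: "Well_order r" and bg: "b \<in> Field r" "g \<in> Field r"
    and ends: "\<forall>i\<in>Field r. (b, i) \<in> r \<and> (i, g) \<in> r"
    and Fid: "\<forall>i\<in>Field r. F i \<in> cstar_ideals A" and Fb: "F b = J" and Fg: "F g = I"
    and step: "\<forall>i\<in>underS r g. ll (dG P) A (F (wo_rel.suc r {i})) (F i)"
    and lim: "\<forall>i. limit_elem r i \<longrightarrow> F i = (\<Inter>j\<in>underS r i. F j)"
    using lld unfolding ll_dual_def by (elim exE conjE) (rule that)
  interpret wo_rel r by (rule wo_rel.intro[OF wo])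
  have anti: "F j \<subseteq> F i" if "(i, j) \<in> r" for i j
  proof (rule descending_chain_antimono[OF wo _ _ lim that])
    show "\<forall>i\<in>Field r. (i, g) \<in> r" using ends by simp
    show "\<forall>i\<in>underS g. F (suc {i}) \<subseteq> F i" by (intro ballI ll_subset[OF bspec[OF step]])
  qed
  define Q where "Q i \<D> \<longleftrightarrow> \<D> \<subseteq> cstar_ideals A \<and> F i \<in> \<D> \<and> (\<forall>M\<in>\<D>. F (suc {i}) \<subseteq> M \<and> M \<subseteq> F i) \<and>
    (\<forall>S. S \<subseteq> \<D> \<longrightarrow> S \<noteq> {} \<longrightarrow> \<Inter>S \<in> \<D>) \<and>
    (\<forall>M\<in>\<D>. M \<noteq> F (suc {i}) \<longrightarrow> (\<exists>M'\<in>\<D>. M' \<noteq> M \<and> ll P A M' M))" for i \<D>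
  have "\<forall>i\<in>underS g. \<exists>\<D>. Q i \<D>"
    unfolding Q_def using step ll_refinement[OF A P] by blast
  from bchoice[OF this] obtain D where D: "\<forall>i\<in>underS g. Q i (D i)" by blast
  note DQ = bspec[OF D, unfolded Q_def]
  define nxt where "nxt M M' \<longleftrightarrow> (\<exists>i\<in>underS g. M \<in> D i \<and> M \<noteq> F (suc {i}) \<and> M' \<in> D i \<and>
    M' \<noteq> M \<and> ll P A M' M)" for M M'
  define \<sigma> where "\<sigma> M = (if \<exists>M'. nxt M M' then SOME M'. nxt M M' else M)" for M
  have \<sigma>: "nxt M (\<sigma> M)" if "\<sigma> M \<noteq> M" for M
    using that someI_ex[of "nxt M"] by (auto simp: \<sigma>_def split: if_splits)
  have \<sigma>_ll: "ll P A (\<sigma> M) M" if "\<sigma> M \<noteq> M" for M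
    using \<sigma>[OF that] by (auto simp: nxt_def)
  have JU: "J \<in> cstar_ideals A" using Fid bg Fb by auto
  have tw: "descending_tower (cstar_ideals A) \<sigma> J"
  proof
    show "\<sigma> M \<in> cstar_ideals A" if "M \<in> cstar_ideals A" for M
      using that \<sigma>_ll[of M] by (cases "\<sigma> M = M") (auto simp: ll_def)
    show "\<sigma> M \<subseteq> M" for M using \<sigma>_ll[of M] by (cases "\<sigma> M = M") (auto simp: ll_def)
  qed (use Inter_in_cstar_ideals[OF A] JU in auto)
  interpret T: descending_tower "cstar_ideals A" \<sigma> J by (rule tw)
  \<comment> \<open>Families of different steps overlap only in end points, so \<open>nxt\<close> never leaves a family.\<close>
  have unique: "i = j" if ij: "i \<in> underS g" "j \<in> underS g" and M: "M \<in> D i" "M \<noteq> F (suc {i})"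
    "M \<in> D j" "M \<noteq> F (suc {j})" for i j M
  proof (rule ccontr)
    have no: False if "(i, j) \<in> r" "i \<noteq> j" "i \<in> underS g" "j \<in> underS g"
      "M \<in> D i" "M \<noteq> F (suc {i})" "M \<in> D j" for i j
    proof -
      have "j \<in> AboveS {i}" using that(1,2) by (auto simp: AboveS_def intro: FieldI2)
      then have "(suc {i}, j) \<in> r" by (rule suc_least_AboveS)
      then have "F j \<subseteq> F (suc {i})" by (rule anti)
      moreover have "M \<subseteq> F j" "F (suc {i}) \<subseteq> M" using DQ[OF that(3)] DQ[OF that(4)] that(5,7) by auto
      ultimately show False using that(6) by auto
    qed
    assume "i \<noteq> j"
    moreover have "i \<in> Field r" "j \<in> Field r" using ij by (auto simp: underS_def intro: FieldI1)
    ultimately show False using TOTALS no[of i j] no[of j i] ij M by auto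
  qed
  have \<sigma>_D: "\<sigma> M \<in> D i \<and> \<sigma> M \<noteq> M" if i: "i \<in> underS g" and M: "M \<in> D i" "M \<noteq> F (suc {i})" for i M
  proof -
    have "\<forall>M\<in>D i. M \<noteq> F (suc {i}) \<longrightarrow> (\<exists>M'\<in>D i. M' \<noteq> M \<and> ll P A M' M)"
      using DQ[OF i] by (elim conjE)
    from mp[OF bspec[OF this M(1)] M(2)]
    obtain M' where "M' \<in> D i" "M' \<noteq> M" "ll P A M' M" by blast
    then have "nxt M M'" using i M unfolding nxt_def by (intro bexI[OF _ i] conjI)
    then have "nxt M (\<sigma> M)" using someI[of "nxt M" M'] by (auto simp: \<sigma>_def)
    then obtain j where j: "j \<in> underS g" "M \<in> D j" "M \<noteq> F (suc {j})" "\<sigma> M \<in> D j" "\<sigma> M \<noteq> M"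
      unfolding nxt_def by (elim bexE conjE) (rule that)
    from unique[OF i j(1) M j(2,3)] j(4,5) show ?thesis by simp
  qed
  have "x \<in> Field r \<longrightarrow> F x \<in> T.tower" for x
  proof (induction x rule: well_order_induct)
    case (1 x)
    then have IH: "F y \<in> T.tower" if "y \<in> underS x" for y
      using that by (auto simp: underS_def intro: FieldI1)
    show ?case
    proof
      assume x: "x \<in> Field r"
      consider "underS x = {}" | "limit_elem r x" | k where "k \<in> underS x" "suc {k} = x"
        using x by (auto simp: limit_elem_def)
      then show "F x \<in> T.tower"
      proof cases
        case 1
        then have "x = b" using ends x by (auto simp: underS_def)
        then show ?thesis using Fb T.bw.iterates_above.base by simp
      next
        case 2
        then have "F x = \<Inter>(F ` underS x)" "underS x \<noteq> {}" using lim by (auto simp: limit_elem_def)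
        then show ?thesis using T.tower_Inter[of "F ` underS x"] IH by auto
      next
        case 3
        have "(k, x) \<in> r" "k \<noteq> x" "(x, g) \<in> r" using 3(1) ends x by (auto simp: underS_def)
        then have kg: "k \<in> underS g" using TRANS ANTISYM by (auto simp: underS_def dest: transD antisymD)
        let ?S = "D k \<inter> T.tower"
        define M where "M = \<Inter>?S"
        have ne: "?S \<noteq> {}" using IH[OF 3(1)] DQ[OF kg] by auto
        have MT: "M \<in> T.tower" unfolding M_def using ne by (intro T.tower_Inter) auto
        have MD: "M \<in> D k" unfolding M_def using ne DQ[OF kg] by auto
        have "M = F x"
        proof (rule ccontr)
          assume "M \<noteq> F x"
          then have s: "\<sigma> M \<in> D k" "\<sigma> M \<noteq> M" using \<sigma>_D[OF kg MD] 3(2) by auto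
          then have "\<sigma> M \<in> ?S" using T.bw.iterates_above.step[OF MT] by simp
          then have "M \<subseteq> \<sigma> M" by (subst (1) M_def) (rule Inter_lower)
          with T.step_subset[OF T.tower_U[OF MT]] have "\<sigma> M = M" by (rule subset_antisym)
          then show False using s(2) by simp
        qed
        then show ?thesis using MT by simp
      qed
    qed
  qed
  then have IT: "I \<in> T.tower" using bg Fg by auto
  show ?thesis
  proof (rule tower_imp_ll_dual[OF tw _ IT])
    show "ll P A (\<sigma> M) M" if "\<sigma> M \<noteq> M" for M by (rule \<sigma>_ll[OF that])
  qed
qed

lemma ll_mono: "P \<subseteq> P1 \<Longrightarrow> ll P A I J \<Longrightarrow> ll P1 A I J"
  using quotient_in_mono[of P P1 A J I] by (simp add: ll_def)

lemma ll_dual_mono: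
  assumes "P \<subseteq> P1" "ll_dual P A I J"
  shows "ll_dual P1 A I J"
proof -
  obtain r :: "'a set rel" and b g F where *: "Well_order r" "b \<in> Field r" "g \<in> Field r"
    "\<forall>i\<in>Field r. (b, i) \<in> r \<and> (i, g) \<in> r" "\<forall>i\<in>Field r. F i \<in> cstar_ideals A" "F b = J" "F g = I"
    and step: "\<forall>i\<in>underS r g. ll P A (F (wo_rel.suc r {i})) (F i)"
    and lim: "\<forall>i. limit_elem r i \<longrightarrow> F i = (\<Inter>j\<in>underS r i. F j)"
    using assms(2) unfolding ll_dual_def by (elim exE conjE) (rule that)
  have "\<forall>i\<in>underS r g. ll P1 A (F (wo_rel.suc r {i})) (F i)"
    using step ll_mono[OF assms(1)] by auto
  with * lim show ?thesis unfolding ll_dual_def by (intro exI conjI)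
qed

lemma dual_radical_antimono: "P \<subseteq> P1 \<Longrightarrow> dual_radical P1 A \<subseteq> dual_radical P A"
  unfolding dual_radical_def by (intro Inter_anti_mono) (auto intro: ll_dual_mono)

text \<open>The end points of chains for \<open>dG P\<close> are also reached by chains for \<open>P\<close>.\<close>

lemma dual_radical_dG:
  assumes "cstar_algebra A" "\<forall>B\<in>P. cstar_algebra B"
  shows "dual_radical P A \<subseteq> dual_radical (dG P) A"
  unfolding dual_radical_def
  by (intro Inter_anti_mono) (auto intro: ll_dual_dG_imp_ll_dual[OF assms])

theorem proposition4p18:
  shows
    "\<comment> \<open>(i)\<close>
     ((\<forall>P\<in>(P_lo :: 'a cstar set set). dG P \<in> P_lo \<and> P \<subseteq> dG P \<and> dG P = dG (dG P)) \<and>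
      (\<forall>P\<in>(P_lo :: 'a cstar set set). \<forall>P1\<in>P_lo. P \<subseteq> P1 \<longrightarrow>
         dG P \<subseteq> dG P1 \<and>
         (\<forall>A. cstar_algebra A \<longrightarrow> dual_radical P1 A \<subseteq> dual_radical P A))) \<and>
     \<comment> \<open>(ii)\<close>
     (\<forall>P\<in>(P_lo :: 'a cstar set set). \<forall>P1\<in>P_lo. P \<subseteq> dG P1 \<longrightarrow> dG P \<subseteq> dG P1) \<and>
     \<comment> \<open>(iii)\<close>
     (\<forall>P\<in>(P_lo :: 'a cstar set set). \<forall>P1\<in>P_lo. P \<subseteq> P1 \<and> P1 \<subseteq> dG P \<longrightarrow>
         dG P = dG P1 \<and>
         (\<forall>A. cstar_algebra A \<longrightarrow> dual_radical P A = dual_radical P1 A))"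
proof -
  have absorb: "dG P \<subseteq> dG P1" if "P1 \<in> P_lo" "P \<subseteq> dG P1" for P P1 :: "'a cstar set"
    using dG_mono[OF that(2)] dG_dG[OF that(1)] by simp
  have radical: "dual_radical P A = dual_radical P1 A"
    if "P \<in> P_lo" "P \<subseteq> P1" "P1 \<subseteq> dG P" "cstar_algebra A" for P P1 and A :: "'a cstar"
  proof (rule subset_antisym)
    have "dual_radical P A \<subseteq> dual_radical (dG P) A"
      by (rule dual_radical_dG[OF that(4) P_loD(1)[OF that(1)]])
    also have "\<dots> \<subseteq> dual_radical P1 A" by (rule dual_radical_antimono[OF that(3)])
    finally show "dual_radical P A \<subseteq> dual_radical P1 A" .
    show "dual_radical P1 A \<subseteq> dual_radical P A" by (rule dual_radical_antimono[OF that(2)])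
  qed
  show ?thesis
  proof (intro conjI ballI impI allI)
    show "dG Q = dG (dG Q)" if "Q \<in> P_lo" for Q :: "'a cstar set"
      using dG_dG[OF that] by simp
  next
    fix P P1 :: "'a cstar set" assume "P \<in> P_lo" "P1 \<in> P_lo" and sub: "P \<subseteq> P1 \<and> P1 \<subseteq> dG P"
    show "dG P = dG P1" using dG_mono[of P P1] absorb[OF \<open>P \<in> P_lo\<close>, of P1] sub by simp
    show "dual_radical P A = dual_radical P1 A" if "cstar_algebra A" for A
      using radical[OF \<open>P \<in> P_lo\<close> _ _ that] sub by simp
  qed (simp_all add: dG_in_P_lo subset_dG dG_mono dual_radical_antimono absorb)
qed

end
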